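(* Let $\Bbbk$ be a field of characteristic zero and let $A$ be an infinite-dimensional $\Bbbk$-algebra. View $A$ as a Lie algebra over $\Bbbk$ with the commutator bracket $[a,b]=ab-ba$. Then the universal enveloping algebra $U(A)$ of this Lie algebra is not noetherian.
   Context: $\Bbbk$-algebras are associative with identity, not necessarily commutative or finitely generated. Infinite-dimensional means infinite-dimensional as a $\Bbbk$-vector space. A ring is called noetherian if it is both left and right noetherian. *)

theory Defs
  imports "HOL-Library.Poly_Mapping" "HOL-Algebra.QuotRing" "HOL-Algebra.Algebraic_Closure_Type"
begin

section \<open>Associative algebras and Lie algebras over a field\<close>

text \<open>The field is the type \<^typ>\<open>'k\<close>; it acts on the underlying additive group by \<open>scale\<close>.\<close>

locale unital_algebra = vector_space scale
  for scale :: "'k::field \<Rightarrow> 'a::ring_1 \<Rightarrow> 'a" +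
  assumes scale_mult_left: "scale c x * y = scale c (x * y)"
    and scale_mult_right: "x * scale c y = scale c (x * y)"

definition infinite_dimensional :: "('k::field \<Rightarrow> 'a::ab_group_add \<Rightarrow> 'a) \<Rightarrow> bool"
  where "infinite_dimensional scale \<longleftrightarrow> \<not> (\<exists>B. finite B \<and> module.span scale B = UNIV)"

locale lie_algebra = vector_space scale
  for scale :: "'k::field \<Rightarrow> 'l::ab_group_add \<Rightarrow> 'l" +
  fixes bracket :: "'l \<Rightarrow> 'l \<Rightarrow> 'l"
  assumes bracket_add_left: "bracket (x + y) z = bracket x z + bracket y z"
    and bracket_add_right: "bracket x (y + z) = bracket x y + bracket x z"
    and bracket_scale_left: "bracket (scale c x) y = scale c (bracket x y)"
    and bracket_scale_right: "bracket x (scale c y) = scale c (bracket x y)"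
    and bracket_self: "bracket x x = 0"
    and jacobi: "bracket x (bracket y z) + bracket y (bracket z x) + bracket z (bracket x y) = 0"

definition commutator :: "'a::ring \<Rightarrow> 'a \<Rightarrow> 'a"
  where "commutator x y = x * y - y * x"

lemma (in unital_algebra) lie_algebra_commutator: "lie_algebra scale commutator"
  by unfold_locales
    (simp_all add: commutator_def algebra_simps scale_mult_left scale_mult_right)


section \<open>The free associative algebra on a set\<close>

text \<open>
  The free monoid is written additively because the multiplication of \<^type>\<open>poly_mapping\<close> is
  convolution over an additive monoid of exponents. Thus the type
  \<open>'v free_monoid \<Rightarrow>\<^sub>0 'k\<close> is the monoid algebra of the free monoid on \<^typ>\<open>'v\<close>.
\<close>

datatype 'v free_monoid = Word (letters: "'v list")

instantiation free_monoid :: (type) monoid_add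
begin

definition zero_free_monoid :: "'v free_monoid"
  where "zero_free_monoid = Word []"

definition plus_free_monoid :: "'v free_monoid \<Rightarrow> 'v free_monoid \<Rightarrow> 'v free_monoid"
  where "plus_free_monoid u v = Word (letters u @ letters v)"

instance
  by standard (simp_all add: zero_free_monoid_def plus_free_monoid_def)

end

definition free_const :: "'k::field \<Rightarrow> 'v free_monoid \<Rightarrow>\<^sub>0 'k"
  where "free_const c = Poly_Mapping.single 0 c"

definition free_gen :: "'v \<Rightarrow> 'v free_monoid \<Rightarrow>\<^sub>0 'k::field"
  where "free_gen x = Poly_Mapping.single (Word [x]) 1"

abbreviation free_algebra :: "('v free_monoid \<Rightarrow>\<^sub>0 'k::field) ring"
  where "free_algebra \<equiv> ring_of_type_algebra"


section \<open>The tensor algebra of a vector space\<close>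

text \<open>
  The \<open>n\<close>-th tensor power of \<open>V\<close> is the vector space with basis \<open>V\<^sup>n\<close> modulo the multilinearity
  relations. Taking the direct sum over \<open>n\<close> gives the free algebra on the set \<open>V\<close> modulo the
  two-sided ideal generated by the linearity relations below.
\<close>

definition tensor_ideal ::
    "('k::field \<Rightarrow> 'v::ab_group_add \<Rightarrow> 'v) \<Rightarrow> ('v free_monoid \<Rightarrow>\<^sub>0 'k) set"
  where "tensor_ideal scale = Idl\<^bsub>free_algebra\<^esub>
    ({free_gen (x + y) - (free_gen x + free_gen y) | x y. True}
     \<union> {free_gen (scale c x) - free_const c * free_gen x | c x. True})"

definition tensor_algebra ::
    "('k::field \<Rightarrow> 'v::ab_group_add \<Rightarrow> 'v) \<Rightarrow> ('v free_monoid \<Rightarrow>\<^sub>0 'k) set ring"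
  where "tensor_algebra scale = free_algebra Quot tensor_ideal scale"

definition tensor_incl ::
    "('k::field \<Rightarrow> 'v::ab_group_add \<Rightarrow> 'v) \<Rightarrow> 'v \<Rightarrow> ('v free_monoid \<Rightarrow>\<^sub>0 'k) set"
  where "tensor_incl scale x = tensor_ideal scale +>\<^bsub>free_algebra\<^esub> free_gen x"


section \<open>The universal enveloping algebra of a Lie algebra\<close>

definition enveloping_ideal ::
    "('k::field \<Rightarrow> 'l::ab_group_add \<Rightarrow> 'l) \<Rightarrow> ('l \<Rightarrow> 'l \<Rightarrow> 'l) \<Rightarrow> ('l free_monoid \<Rightarrow>\<^sub>0 'k) set set"
  where "enveloping_ideal scale bracket =
    (let T = tensor_algebra scale; \<iota> = tensor_incl scale
     in Idl\<^bsub>T\<^esub> {(\<iota> x \<otimes>\<^bsub>T\<^esub> \<iota> y \<ominus>\<^bsub>T\<^esub> \<iota> y \<otimes>\<^bsub>T\<^esub> \<iota> x) \<ominus>\<^bsub>T\<^esub> \<iota> (bracket x y) | x y. True})"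

definition universal_enveloping_algebra ::
    "('k::field \<Rightarrow> 'l::ab_group_add \<Rightarrow> 'l) \<Rightarrow> ('l \<Rightarrow> 'l \<Rightarrow> 'l) \<Rightarrow> ('l free_monoid \<Rightarrow>\<^sub>0 'k) set set ring"
  where "universal_enveloping_algebra scale bracket =
    tensor_algebra scale Quot enveloping_ideal scale bracket"

lemma ring_ring_of_type_algebra: "ring (ring_of_type_algebra :: 'a::ring_1 ring)"
proof -
  have "\<exists>y. y + x = 0 \<and> x + y = 0" for x :: 'a
    by (rule exI[of _ "- x"]) simp
  then show ?thesis
    unfolding ring_of_type_algebra_def
    by unfold_locales (auto simp: algebra_simps Units_def)
qed

lemma ideal_tensor_ideal: "ideal (tensor_ideal scale) free_algebra"
  unfolding tensor_ideal_def
  by (rule ring.genideal_ideal[OF ring_ring_of_type_algebra])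
    (simp add: ring_of_type_algebra_def)

lemma ring_tensor_algebra: "ring (tensor_algebra scale)"
  unfolding tensor_algebra_def by (rule ideal.quotient_is_ring[OF ideal_tensor_ideal])

lemma tensor_incl_closed: "tensor_incl scale x \<in> carrier (tensor_algebra scale)"
  unfolding tensor_incl_def tensor_algebra_def FactRing_def A_RCOSETS_def'
  by (auto simp: ring_of_type_algebra_def)

lemma ideal_enveloping_ideal:
  "ideal (enveloping_ideal scale bracket) (tensor_algebra scale)"
proof -
  interpret T: ring "tensor_algebra scale" by (rule ring_tensor_algebra)
  show ?thesis
    unfolding enveloping_ideal_def Let_def
    by (rule T.genideal_ideal) (auto intro!: T.minus_closed T.m_closed tensor_incl_closed)
qed

lemma ring_universal_enveloping_algebra: "ring (universal_enveloping_algebra scale bracket)"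
  unfolding universal_enveloping_algebra_def
  by (rule ideal.quotient_is_ring[OF ideal_enveloping_ideal])


section \<open>Noetherian rings\<close>

text \<open>
  The library's \<open>noetherian_ring\<close> speaks about two-sided ideals only, so the one-sided notions
  are introduced here.
\<close>

locale left_ideal = additive_subgroup I R + ring R for I and R (structure) +
  assumes left_closed: "\<lbrakk>a \<in> I; x \<in> carrier R\<rbrakk> \<Longrightarrow> x \<otimes> a \<in> I"

locale right_ideal = additive_subgroup I R + ring R for I and R (structure) +
  assumes right_closed: "\<lbrakk>a \<in> I; x \<in> carrier R\<rbrakk> \<Longrightarrow> a \<otimes> x \<in> I"

definition left_noetherian :: "('a, 'b) ring_scheme \<Rightarrow> bool"
  where "left_noetherian R \<longleftrightarrow>
    (\<forall>I :: nat \<Rightarrow> 'a set. (\<forall>n. left_ideal (I n) R) \<and> (\<forall>n. I n \<subseteq> I (Suc n))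
      \<longrightarrow> (\<exists>N. \<forall>n\<ge>N. I n = I N))"

definition right_noetherian :: "('a, 'b) ring_scheme \<Rightarrow> bool"
  where "right_noetherian R \<longleftrightarrow>
    (\<forall>I :: nat \<Rightarrow> 'a set. (\<forall>n. right_ideal (I n) R) \<and> (\<forall>n. I n \<subseteq> I (Suc n))
      \<longrightarrow> (\<exists>N. \<forall>n\<ge>N. I n = I N))"

definition noetherian :: "('a, 'b) ring_scheme \<Rightarrow> bool"
  where "noetherian R \<longleftrightarrow> left_noetherian R \<and> right_noetherian R"

end

(*
  A Lie module M with a vector v turns an ascending chain of submodules of M into an ascending
  chain of left ideals {u. u v in M_n} of U(A). Taking M = A with left (negated right)
  multiplication, left noetherianity of U(A) gives the ascending chain condition for left (right)
  ideals of A.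

  For a two-sided ideal I, A acts on the symmetric algebra of A/I by a |-> M_a + L_a, with M_a the
  multiplication by a and L_a the derivation extending left multiplication; this commutes with the
  operators M_c + R_c built from right multiplication. If the elements c_n commute modulo I and are
  linearly independent modulo I, the images of the M_c + R_c, c in {c_0, ..., c_(n-1)}, sum up to
  submodules that separate the c_n, as in the Poincare-Birkhoff-Witt theorem. Hence commutative
  subspaces of A/I are finite-dimensional.

  Now choose I maximal with A/I infinite-dimensional. Then A/I is prime, algebraic and noetherian,
  so it contains an idempotent e with eAe a division algebra. Density over a maximal commutative
  subspace makes eAe finite-dimensional, chain conditions extend this to eA, and A/I embeds into
  the endomorphisms of eA.
*)
theory Submission
  imports Defs
begin

section \<open>Lie modules and left ideals of the enveloping algebra\<close>

text \<open>Chains of left ideals of \<open>U(A)\<close> are observed through one vector of a module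
  and on elements of A only. On the symmetric algebra that vector is 1: there M_c + L_c and M_c +
  R_c both give c, so c_n lies in the submodule built from c_0, ..., c_n, while separation keeps it
  out of the one built from c_0, ..., c_(n-1). The two families commute because L_a and R_c are
  derivations: [L_a, M_c] = M_(ac) cancels [M_a, R_c] = -M_(ac), and L_a commutes with R_c by
  associativity of A. The bound on commuting families is used twice: for the powers of one element
  it means algebraicity, and inside eAe it yields a finite maximal commuting set. Elements of A are
  compared modulo I throughout, in place of a separate quotient type for each I.\<close>

lemma poly_mapping_add_induct [case_names single add]:
  fixes P :: "('x \<Rightarrow>\<^sub>0 'c::comm_monoid_add) \<Rightarrow> bool"
  assumes "\<And>k c. P (Poly_Mapping.single k c)" and "\<And>p q. P p \<Longrightarrow> P q \<Longrightarrow> P (p + q)"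
  shows "P p"
proof -
  have *: "P (\<Sum>k\<in>K. Poly_Mapping.single k (Poly_Mapping.lookup p k))" if "finite K" for K
    using that
  proof (induction K)
    case empty
    show ?case using assms(1)[of undefined 0] by simp
  next
    case (insert k K)
    then show ?case by (simp add: assms)
  qed
  have "p = (\<Sum>k\<in>Poly_Mapping.keys p. Poly_Mapping.single k (Poly_Mapping.lookup p k))"
    by (rule poly_mapping_eqI) (simp add: lookup_sum lookup_single when_def in_keys_iff)
  with *[of "Poly_Mapping.keys p"] show ?thesis by simp
qed

definition lin_ext :: "('k::zero \<Rightarrow> 'b \<Rightarrow> 'b) \<Rightarrow> ('x \<Rightarrow> 'b) \<Rightarrow> ('x \<Rightarrow>\<^sub>0 'k) \<Rightarrow> 'b::comm_monoid_add"
  where "lin_ext scale h p = (\<Sum>k\<in>Poly_Mapping.keys p. scale (Poly_Mapping.lookup p k) (h k))"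

context vector_space
begin

lemma lin_ext_superset:
  assumes "finite K" "Poly_Mapping.keys p \<subseteq> K"
  shows "lin_ext scale h p = (\<Sum>k\<in>K. scale (Poly_Mapping.lookup p k) (h k))"
  unfolding lin_ext_def using assms
  by (intro sum.mono_neutral_left) (auto simp: in_keys_iff)

lemma lin_ext_add: "lin_ext scale h (p + q) = lin_ext scale h p + lin_ext scale h q"
proof -
  let ?K = "Poly_Mapping.keys p \<union> Poly_Mapping.keys q"
  have "lin_ext scale h r = (\<Sum>k\<in>?K. scale (Poly_Mapping.lookup r k) (h k))" if "r \<in> {p, q, p + q}" for r
    using that keys_add[of p q] by (intro lin_ext_superset) auto
  then show ?thesis
    by (simp add: lookup_add scale_left_distrib sum.distrib)
qed

lemma lin_ext_single [simp]: "lin_ext scale h (Poly_Mapping.single k c) = scale c (h k)"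
  by (simp add: lin_ext_def)

lemma lin_ext_zero [simp]: "lin_ext scale h 0 = 0"
  by (simp add: lin_ext_def)

lemma lin_ext_diff: "lin_ext scale h (p - q) = lin_ext scale h p - lin_ext scale h q"
  using lin_ext_add[of h "p - q" q] by (simp add: algebra_simps)

end

section \<open>Ideals along surjective homomorphisms, and the projection onto the enveloping
  algebra\<close>

lemma left_ideal_hom_image:
  assumes "ring_hom_ring R S h" and surj: "h ` carrier R = carrier S" and "left_ideal J R"
  shows "left_ideal (h ` J) S"
proof -
  interpret h: ring_hom_ring R S h by fact
  interpret J: left_ideal J R by fact
  show ?thesis
  proof (unfold_locales)
    show "h ` J \<subseteq> carrier (add_monoid S)"
      using J.a_subset by auto
    show "x \<otimes>\<^bsub>add_monoid S\<^esub> y \<in> h ` J" if xy: "x \<in> h ` J" "y \<in> h ` J" for x y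
    proof -
      obtain u v where "u \<in> J" "v \<in> J" "x = h u" "y = h v" using xy by auto
      then have "x \<oplus>\<^bsub>S\<^esub> y = h (u \<oplus>\<^bsub>R\<^esub> v)" "u \<oplus>\<^bsub>R\<^esub> v \<in> J" 
        using J.a_subset by auto
      then show ?thesis by auto
    qed
    show "\<one>\<^bsub>add_monoid S\<^esub> \<in> h ` J"
      using J.zero_closed h.hom_zero by (metis image_eqI monoid.simps(2))
    show "inv\<^bsub>add_monoid S\<^esub> x \<in> h ` J" if x: "x \<in> h ` J" for x
    proof -
      obtain u where u: "u \<in> J" "x = h u" using x by auto
      then have "\<ominus>\<^bsub>R\<^esub> u \<in> J" by auto
      moreover have "\<ominus>\<^bsub>S\<^esub> x = h (\<ominus>\<^bsub>R\<^esub> u)" using u J.a_subset by auto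
      ultimately show ?thesis by (auto simp: a_inv_def)
    qed
    show "s \<otimes>\<^bsub>S\<^esub> x \<in> h ` J" if xs: "x \<in> h ` J" "s \<in> carrier S" for x s
    proof -
      obtain u r where "u \<in> J" "x = h u" "r \<in> carrier R" "s = h r"
        using xs surj by (metis imageE)
      then have "s \<otimes>\<^bsub>S\<^esub> x = h (r \<otimes>\<^bsub>R\<^esub> u)" "r \<otimes>\<^bsub>R\<^esub> u \<in> J"
        using J.a_subset J.left_closed by auto
      then show ?thesis by auto
    qed
  qed
qed

lemma ideal_hom_image:
  assumes "ring_hom_ring R S h" and surj: "h ` carrier R = carrier S" and "ideal J R"
  shows "ideal (h ` J) S"
proof -
  interpret h: ring_hom_ring R S h by fact
  interpret J: ideal J R by fact
  have "left_ideal J R"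
    by unfold_locales (auto intro: J.I_l_closed)
  with assms have "left_ideal (h ` J) S" by (intro left_ideal_hom_image)
  then interpret left_ideal "h ` J" S .
  show ?thesis
  proof unfold_locales
    show "s \<otimes>\<^bsub>S\<^esub> x \<in> h ` J" if "x \<in> h ` J" "s \<in> carrier S" for x s
      using that by (rule left_closed)
    show "x \<otimes>\<^bsub>S\<^esub> s \<in> h ` J" if xs: "x \<in> h ` J" "s \<in> carrier S" for x s
    proof -
      obtain u r where "u \<in> J" "x = h u" "r \<in> carrier R" "s = h r"
        using xs surj by (metis imageE)
      then have "x \<otimes>\<^bsub>S\<^esub> s = h (u \<otimes>\<^bsub>R\<^esub> r)" "u \<otimes>\<^bsub>R\<^esub> r \<in> J"
        using J.a_subset J.I_r_closed by auto
      then show ?thesis by auto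
    qed
  qed
qed

lemma Quot_proj_surj: "(+>\<^bsub>R\<^esub>) I ` carrier R = carrier (R Quot I)"
  by (auto simp: FactRing_def A_RCOSETS_def')

lemma ring_type_simps [simp]:
  "carrier ring_of_type_algebra = UNIV"
  "x \<otimes>\<^bsub>ring_of_type_algebra\<^esub> y = x * y"
  "x \<oplus>\<^bsub>ring_of_type_algebra\<^esub> y = x + y"
  "\<zero>\<^bsub>ring_of_type_algebra\<^esub> = 0"
  "\<one>\<^bsub>ring_of_type_algebra\<^esub> = 1"
  for x y :: "'a::ring_1"
  by (simp_all add: ring_of_type_algebra_def)

lemma uminus_ring_type [simp]: "\<ominus>\<^bsub>ring_of_type_algebra\<^esub> x = - x" for x :: "'a::ring_1"
proof -
  interpret ring "ring_of_type_algebra :: 'a ring" by (rule ring_ring_of_type_algebra)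
  show ?thesis by (rule minus_equality) auto
qed

text \<open>Elements of the enveloping algebra are cosets of cosets. With this composite projection
  the left ideals can be built from representatives in the free algebra and pushed forward.\<close>

definition env_proj ::
    "('k::field \<Rightarrow> 'l::ab_group_add \<Rightarrow> 'l) \<Rightarrow> ('l \<Rightarrow> 'l \<Rightarrow> 'l) \<Rightarrow> ('l free_monoid \<Rightarrow>\<^sub>0 'k)
      \<Rightarrow> ('l free_monoid \<Rightarrow>\<^sub>0 'k) set set"
  where "env_proj scale bracket p =
    enveloping_ideal scale bracket +>\<^bsub>tensor_algebra scale\<^esub> (tensor_ideal scale +>\<^bsub>free_algebra\<^esub> p)"

lemma tensor_proj_hom:
  "ring_hom_ring free_algebra (tensor_algebra scale) ((+>\<^bsub>free_algebra\<^esub>) (tensor_ideal scale))"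
  unfolding tensor_algebra_def by (rule ideal.rcos_ring_hom_ring[OF ideal_tensor_ideal])

lemma env_proj_hom:
  "ring_hom_ring free_algebra (universal_enveloping_algebra scale bracket) (env_proj scale bracket)"
proof -
  have "ring_hom_ring (tensor_algebra scale) (universal_enveloping_algebra scale bracket)
      ((+>\<^bsub>tensor_algebra scale\<^esub>) (enveloping_ideal scale bracket))"
    unfolding universal_enveloping_algebra_def
    by (rule ideal.rcos_ring_hom_ring[OF ideal_enveloping_ideal])
  then have "(+>\<^bsub>tensor_algebra scale\<^esub>) (enveloping_ideal scale bracket)
      \<in> ring_hom (tensor_algebra scale) (universal_enveloping_algebra scale bracket)"
    by (rule ring_hom_ring.homh)
  from ring_hom_trans[OF ring_hom_ring.homh[OF tensor_proj_hom] this]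
  show ?thesis
    by (intro ring_hom_ringI2 ring_ring_of_type_algebra ring_universal_enveloping_algebra)
      (simp add: env_proj_def[abs_def] comp_def)
qed

lemma env_proj_surj:
  "env_proj scale bracket ` UNIV = carrier (universal_enveloping_algebra scale bracket)"
proof -
  have "range (env_proj scale bracket)
      = (+>\<^bsub>tensor_algebra scale\<^esub>) (enveloping_ideal scale bracket)
          ` (+>\<^bsub>free_algebra\<^esub>) (tensor_ideal scale) ` carrier free_algebra"
    by (auto simp: env_proj_def[abs_def] image_image)
  also have "\<dots> = carrier (universal_enveloping_algebra scale bracket)"
    unfolding universal_enveloping_algebra_def Quot_proj_surj[symmetric]
    by (simp only: Quot_proj_surj tensor_algebra_def)
  finally show ?thesis .
qed

text \<open>The kernel of the projection is the least ideal containing the linearity and bracket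
  relations: \<open>K\<close> contains the tensor ideal and its image contains the enveloping ideal,
  so \<open>p\<close> agrees with an element of \<open>K\<close> up to the tensor ideal.\<close>

lemma env_proj_eq_zero_imp:
  fixes scale :: "'k::field \<Rightarrow> 'l::ab_group_add \<Rightarrow> 'l"
  assumes K: "ideal K free_algebra"
    and add: "\<And>x y. free_gen (x + y) - (free_gen x + free_gen y) \<in> K"
    and scale: "\<And>c x. free_gen (scale c x) - free_const c * free_gen x \<in> K"
    and bracket: "\<And>x y. free_gen x * free_gen y - free_gen y * free_gen x - free_gen (bracket x y) \<in> K"
    and p: "env_proj scale bracket p = \<zero>\<^bsub>universal_enveloping_algebra scale bracket\<^esub>"
  shows "p \<in> K"
proof -
  let ?T = "tensor_algebra scale" and ?\<tau> = "(+>\<^bsub>free_algebra\<^esub>) (tensor_ideal scale)"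
  interpret F: ring free_algebra by (rule ring_ring_of_type_algebra)
  interpret T: ring ?T by (rule ring_tensor_algebra)
  interpret tau: ring_hom_ring free_algebra ?T ?\<tau> by (rule tensor_proj_hom)
  interpret TI: ideal "tensor_ideal scale" free_algebra by (rule ideal_tensor_ideal)
  interpret EI: ideal "enveloping_ideal scale bracket" ?T by (rule ideal_enveloping_ideal)
  interpret K: ideal K free_algebra by (rule K)
  have TI: "tensor_ideal scale \<subseteq> K"
    unfolding tensor_ideal_def by (rule F.genideal_minimal[OF K]) (use add scale in auto)
  have "ideal (?\<tau> ` K) ?T"
    by (rule ideal_hom_image[OF tensor_proj_hom _ K]) (simp only: Quot_proj_surj tensor_algebra_def)
  moreover have "(tensor_incl scale x \<otimes>\<^bsub>?T\<^esub> tensor_incl scale y \<ominus>\<^bsub>?T\<^esub>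
      tensor_incl scale y \<otimes>\<^bsub>?T\<^esub> tensor_incl scale x) \<ominus>\<^bsub>?T\<^esub> tensor_incl scale (bracket x y)
    = ?\<tau> (free_gen x * free_gen y - free_gen y * free_gen x - free_gen (bracket x y))" for x y
  proof -
    have m: "?\<tau> (a - b) = ?\<tau> a \<ominus>\<^bsub>?T\<^esub> ?\<tau> b" for a b
      using tau.hom_add[of a "- b"] tau.hom_a_inv[of b] by (simp add: a_minus_def)
    have "?\<tau> (a * b) = ?\<tau> a \<otimes>\<^bsub>?T\<^esub> ?\<tau> b" for a b
      using tau.hom_mult[of a b] by simp
    then show ?thesis by (simp add: tensor_incl_def m)
  qed
  ultimately have EI: "enveloping_ideal scale bracket \<subseteq> ?\<tau> ` K"
    unfolding enveloping_ideal_def Let_def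
    by (intro T.genideal_minimal) (use bracket in auto)
  have "?\<tau> p \<in> carrier ?T" using tau.hom_closed[of p] by simp
  moreover have "enveloping_ideal scale bracket +>\<^bsub>?T\<^esub> ?\<tau> p = enveloping_ideal scale bracket"
    using p by (simp add: env_proj_def universal_enveloping_algebra_def FactRing_def)
  ultimately have "?\<tau> p \<in> enveloping_ideal scale bracket" by (rule EI.rcos_const_imp_mem)
  with EI obtain k where k: "k \<in> K" "?\<tau> p = ?\<tau> k" by auto
  then have "p \<in> tensor_ideal scale +>\<^bsub>free_algebra\<^esub> k"
    using TI.a_rcos_self[of p] by simp
  then obtain t where "t \<in> tensor_ideal scale" "p = t + k"
    by (auto simp: a_r_coset_def')
  with TI k K.a_closed[of t k] show ?thesis by auto
qed

section \<open>Lie modules as modules over the enveloping algebra\<close>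

locale lie_module = vector_space scaleV
  for scaleV :: "'k::field \<Rightarrow> 'v::ab_group_add \<Rightarrow> 'v" +
  fixes scale :: "'k \<Rightarrow> 'l::ab_group_add \<Rightarrow> 'l" and bracket :: "'l \<Rightarrow> 'l \<Rightarrow> 'l"
    and act :: "'l \<Rightarrow> 'v \<Rightarrow> 'v"
  assumes act_add: "act a (v + w) = act a v + act a w"
    and act_scale: "act a (scaleV c v) = scaleV c (act a v)"
    and add_act: "act (a + b) v = act a v + act b v"
    and scale_act: "act (scale c a) v = scaleV c (act a v)"
    and bracket_act: "act (bracket a b) v = act a (act b v) - act b (act a v)"
begin

text \<open>With \<open>foldr\<close> the rightmost letter acts first, so concatenation of words
  becomes composition of operators.\<close>

definition word_act :: "'l free_monoid \<Rightarrow> 'v \<Rightarrow> 'v"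
  where "word_act u = foldr act (letters u)"

definition poly_act :: "('l free_monoid \<Rightarrow>\<^sub>0 'k) \<Rightarrow> 'v \<Rightarrow> 'v"
  where "poly_act p v = lin_ext scaleV (\<lambda>u. word_act u v) p"

lemma word_act_add: "word_act u (v + w) = word_act u v + word_act u w"
proof -
  have "foldr act xs (v + w) = foldr act xs v + foldr act xs w" for xs
    by (induction xs) (auto simp: act_add)
  then show ?thesis by (simp add: word_act_def)
qed

lemma word_act_scale: "word_act u (scaleV c v) = scaleV c (word_act u v)"
proof -
  have "foldr act xs (scaleV c v) = scaleV c (foldr act xs v)" for xs
    by (induction xs) (auto simp: act_scale)
  then show ?thesis by (simp add: word_act_def)
qed

lemma word_act_plus: "word_act (u + w) v = word_act u (word_act w v)"
  by (simp add: word_act_def plus_free_monoid_def)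

lemma poly_act_add: "poly_act (p + q) v = poly_act p v + poly_act q v"
  by (simp add: poly_act_def lin_ext_add)

lemma poly_act_diff: "poly_act (p - q) v = poly_act p v - poly_act q v"
  by (simp add: poly_act_def lin_ext_diff)

lemma poly_act_zero [simp]: "poly_act 0 v = 0"
  by (simp add: poly_act_def)

lemma poly_act_single: "poly_act (Poly_Mapping.single u c) v = scaleV c (word_act u v)"
  by (simp add: poly_act_def)

lemma poly_act_add_right: "poly_act p (v + w) = poly_act p v + poly_act p w"
  by (simp add: poly_act_def lin_ext_def word_act_add scale_right_distrib sum.distrib)

lemma poly_act_zero_right [simp]: "poly_act p 0 = 0"
  using poly_act_add_right[of p 0 0] by simp

lemma poly_act_mult: "poly_act (p * q) v = poly_act p (poly_act q v)"
proof (induction p rule: poly_mapping_add_induct)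
  case (single u c)
  show ?case
    by (induction q rule: poly_mapping_add_induct)
      (simp_all add: mult_single poly_act_single word_act_plus word_act_scale poly_act_add
        poly_act_add_right distrib_left)
qed (simp add: distrib_right poly_act_add)

lemma poly_act_gen [simp]: "poly_act (free_gen x) v = act x v"
  by (simp add: free_gen_def poly_act_single word_act_def)

lemma poly_act_const [simp]: "poly_act (free_const c) v = scaleV c v"
  by (simp add: free_const_def poly_act_single word_act_def zero_free_monoid_def)

lemma ideal_annihilator: "ideal {p. \<forall>v. poly_act p v = 0} free_algebra"
proof -
  interpret F: ring "free_algebra :: ('l free_monoid \<Rightarrow>\<^sub>0 'k) ring" by (rule ring_ring_of_type_algebra)
  have "poly_act (- p) v = - poly_act p v" for p v
    using poly_act_diff[of 0 p v] by simp
  then show ?thesis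
    by (intro idealI ring_ring_of_type_algebra F.add.subgroupI)
      (auto simp: poly_act_add poly_act_mult a_inv_def[symmetric] intro: exI[of _ 0])
qed

text \<open>The annihilator is an ideal, and \<open>add_act\<close>, \<open>scale_act\<close> and
  \<open>bracket_act\<close> put the defining relations into it; so the action of the free algebra
  factors through the enveloping algebra.\<close>

lemma env_proj_annihilates:
  assumes "env_proj scale bracket p = \<zero>\<^bsub>universal_enveloping_algebra scale bracket\<^esub>"
  shows "poly_act p v = 0"
proof -
  have "p \<in> {p. \<forall>v. poly_act p v = 0}"
    by (rule env_proj_eq_zero_imp[OF ideal_annihilator _ _ _ assms])
      (simp_all add: poly_act_diff poly_act_add poly_act_mult add_act scale_act bracket_act)
  then show ?thesis by simp
qed

lemma poly_act_invariant:
  assumes W: "subspace W" and inv: "\<And>a v. v \<in> W \<Longrightarrow> act a v \<in> W" and v: "v \<in> W"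
  shows "poly_act p v \<in> W"
proof -
  have "foldr act xs v \<in> W" for xs
    by (induction xs) (auto simp: v inv)
  then show ?thesis
    by (simp add: poly_act_def lin_ext_def word_act_def subspace_sum subspace_scale W)
qed

text \<open>
  The elements of the enveloping algebra that move \<open>v\<close> into a submodule form a left ideal.
\<close>

theorem left_noetherian_stabilizes:
  assumes noeth: "left_noetherian (universal_enveloping_algebra scale bracket)"
    and W: "\<And>n. subspace (W n)" and inv: "\<And>n a w. w \<in> W n \<Longrightarrow> act a w \<in> W n"
    and mono: "\<And>n. W n \<subseteq> W (Suc n)"
  shows "\<exists>N. \<forall>n\<ge>N. \<forall>a. act a v \<in> W n \<longrightarrow> act a v \<in> W N"
proof -
  let ?U = "universal_enveloping_algebra scale bracket" and ?\<pi> = "env_proj scale bracket"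
  define J where "J n = {p. poly_act p v \<in> W n}" for n
  interpret F: ring "free_algebra :: ('l free_monoid \<Rightarrow>\<^sub>0 'k) ring" by (rule ring_ring_of_type_algebra)
  interpret pi: ring_hom_ring free_algebra ?U ?\<pi> by (rule env_proj_hom)
  have m: "poly_act (- p) v = - poly_act p v" for p v
    using poly_act_diff[of 0 p v] by simp
  have J: "left_ideal (J n) free_algebra" for n
    by (intro left_ideal.intro additive_subgroup.intro F.add.subgroupI ring_ring_of_type_algebra
        left_ideal_axioms.intro)
      (auto simp: J_def poly_act_add poly_act_mult a_inv_def[symmetric] m W subspace_neg subspace_add
        subspace_0 intro: exI[of _ 0] poly_act_invariant[OF W inv])
  have "left_ideal (?\<pi> ` J n) ?U" for n
    by (rule left_ideal_hom_image[OF env_proj_hom _ J]) (simp add: env_proj_surj)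
  moreover have "?\<pi> ` J n \<subseteq> ?\<pi> ` J (Suc n)" for n
    using mono[of n] by (auto simp: J_def)
  ultimately have "\<exists>N. \<forall>n\<ge>N. ?\<pi> ` J n = ?\<pi> ` J N"
    using noeth[unfolded left_noetherian_def, rule_format, of "\<lambda>n. ?\<pi> ` J n"] by simp
  then obtain N where N: "\<And>n. n \<ge> N \<Longrightarrow> ?\<pi> ` J n = ?\<pi> ` J N"
    by blast
  have "act a v \<in> W N" if "n \<ge> N" "act a v \<in> W n" for n a
  proof -
    have "free_gen a \<in> J n" using that by (simp add: J_def)
    with N[OF \<open>n \<ge> N\<close>] obtain q where q: "q \<in> J N" "?\<pi> (free_gen a) = ?\<pi> q"
      by (metis imageE imageI)
    \<comment> \<open>Stability concerns classes, so it only returns some \<open>q\<close> in the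
      class of \<open>free_gen a\<close>; members of one class act alike on
      \<open>v\<close>.\<close>
    have "?\<pi> (free_gen a - q) = \<zero>\<^bsub>?U\<^esub>"
      using pi.hom_add[of "free_gen a" "- q"] pi.hom_a_inv[of q] pi.hom_closed[of q] q(2)
        pi.S.r_neg[of "?\<pi> q"] by simp
    from env_proj_annihilates[OF this, of v] q(1) show ?thesis
      by (simp add: poly_act_diff J_def)
  qed
  then show ?thesis by blast
qed

end

section \<open>Derivations of polynomial rings\<close>

text \<open>\<open>'x multiset\<close> is the free commutative monoid on \<open>'x\<close>, so this
  type is a polynomial ring. It models the symmetric algebra, with basis elements as
  variables.\<close>

definition pscale :: "'k::field \<Rightarrow> ('x multiset \<Rightarrow>\<^sub>0 'k) \<Rightarrow> ('x multiset \<Rightarrow>\<^sub>0 'k)"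
  where "pscale c p = Poly_Mapping.single 0 c * p"

abbreviation var :: "'x \<Rightarrow> ('x multiset \<Rightarrow>\<^sub>0 'k::field)"
  where "var x \<equiv> Poly_Mapping.single {#x#} 1"

interpretation poly: vector_space pscale
  by unfold_locales
    (simp_all add: pscale_def distrib_left distrib_right single_add mult_single flip: mult.assoc)

lemma pscale_mult_left: "pscale c p * q = pscale c (p * q)"
  by (simp add: pscale_def mult.assoc)

lemma pscale_mult_right: "p * pscale c q = pscale c (p * q)"
  by (simp add: pscale_def mult.left_commute)

lemma pscale_single [simp]: "pscale c (Poly_Mapping.single m d) = Poly_Mapping.single m (c * d)"
  by (simp add: pscale_def mult_single)

definition derivation :: "(('x multiset \<Rightarrow>\<^sub>0 'k::field) \<Rightarrow> ('x multiset \<Rightarrow>\<^sub>0 'k)) \<Rightarrow> bool"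
  where "derivation \<delta> \<longleftrightarrow> (\<forall>p q. \<delta> (p + q) = \<delta> p + \<delta> q)
    \<and> (\<forall>c p. \<delta> (pscale c p) = pscale c (\<delta> p)) \<and> (\<forall>p q. \<delta> (p * q) = \<delta> p * q + p * \<delta> q)"

text \<open>The mixed terms \<open>\<delta> p * \<epsilon> q\<close> and
  \<open>\<epsilon> p * \<delta> q\<close> occur in both compositions and cancel.\<close>

lemma derivation_commutator:
  assumes "derivation \<delta>" "derivation \<epsilon>"
  shows "derivation (\<lambda>p. \<delta> (\<epsilon> p) - \<epsilon> (\<delta> p))"
  using assms unfolding derivation_def
  by (auto simp: algebra_simps poly.scale_right_diff_distrib)

text \<open>Derivations kill 1 and obey the Leibniz rule, so the variables determine them. Operator
  identities thereby reduce to identities between products in A.\<close>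

lemma derivation_eqI:
  assumes "derivation \<delta>" "derivation \<epsilon>" and var: "\<And>x. \<delta> (var x) = \<epsilon> (var x)"
  shows "\<delta> p = \<epsilon> p"
proof -
  have one: "\<delta> 1 = 0" if "derivation \<delta>" for \<delta> :: "('a multiset \<Rightarrow>\<^sub>0 'b) \<Rightarrow> ('a multiset \<Rightarrow>\<^sub>0 'b)"
  proof -
    have "\<delta> (1 * 1) = \<delta> 1 * 1 + 1 * \<delta> 1" using that unfolding derivation_def by blast
    then show ?thesis by simp
  qed
  have mono: "\<delta> (Poly_Mapping.single m 1) = \<epsilon> (Poly_Mapping.single m 1)" for m
  proof (induction m)
    case empty
    show ?case using one[OF assms(1)] one[OF assms(2)] by simp
  next
    case (add x m)
    have "Poly_Mapping.single (add_mset x m) 1 = var x * Poly_Mapping.single m 1"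
      by (simp add: mult_single)
    then show ?case
      using assms(1,2) var add unfolding derivation_def by metis
  qed
  show ?thesis
  proof (induction p rule: poly_mapping_add_induct)
    case (single m c)
    have "Poly_Mapping.single m c = pscale c (Poly_Mapping.single m 1)" by simp
    then show ?case using assms(1,2) mono unfolding derivation_def by metis
  next
    case (add p q)
    then show ?case using assms(1,2) unfolding derivation_def by metis
  qed
qed

text \<open>The Leibniz rule on a monomial. The sum runs over occurrences, so the multiplicity of
  \<open>x\<close> supplies the exponent factor of an ordinary derivative.\<close>

definition der_mono :: "('x \<Rightarrow> ('x multiset \<Rightarrow>\<^sub>0 'k::field)) \<Rightarrow> 'x multiset \<Rightarrow> ('x multiset \<Rightarrow>\<^sub>0 'k)"
  where "der_mono h m = (\<Sum>x\<in>#m. Poly_Mapping.single (m - {#x#}) 1 * h x)"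

definition der :: "('x \<Rightarrow> ('x multiset \<Rightarrow>\<^sub>0 'k::field)) \<Rightarrow> ('x multiset \<Rightarrow>\<^sub>0 'k) \<Rightarrow> ('x multiset \<Rightarrow>\<^sub>0 'k)"
  where "der h p = lin_ext pscale (der_mono h) p"

lemma der_mono_plus:
  "der_mono h (m + n)
    = der_mono h m * Poly_Mapping.single n 1 + Poly_Mapping.single m 1 * der_mono h n"
proof -
  have "(\<Sum>x\<in>#m. Poly_Mapping.single (m + n - {#x#}) 1 * h x)
      = (\<Sum>x\<in>#m. (Poly_Mapping.single (m - {#x#}) 1 * h x) * Poly_Mapping.single n 1)"
  proof (rule arg_cong[where f = sum_mset], rule image_mset_cong)
    fix x assume "x \<in># m"
    then have "m + n - {#x#} = (m - {#x#}) + n"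
      by (metis diff_union_single_conv add.commute)
    then have "Poly_Mapping.single (m + n - {#x#}) (1::'b)
        = Poly_Mapping.single (m - {#x#}) 1 * Poly_Mapping.single n 1"
      by (simp add: mult_single)
    then show "Poly_Mapping.single (m + n - {#x#}) 1 * h x
        = (Poly_Mapping.single (m - {#x#}) 1 * h x) * Poly_Mapping.single n 1"
      by (simp add: ac_simps)
  qed
  moreover have "(\<Sum>x\<in>#n. Poly_Mapping.single (m + n - {#x#}) 1 * h x)
      = (\<Sum>x\<in>#n. Poly_Mapping.single m 1 * (Poly_Mapping.single (n - {#x#}) 1 * h x))"
  proof (rule arg_cong[where f = sum_mset], rule image_mset_cong)
    fix x assume "x \<in># n"
    then have "m + n - {#x#} = m + (n - {#x#})"
      by (rule diff_union_single_conv)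
    then have "Poly_Mapping.single (m + n - {#x#}) (1::'b)
        = Poly_Mapping.single m 1 * Poly_Mapping.single (n - {#x#}) 1"
      by (simp add: mult_single)
    then show "Poly_Mapping.single (m + n - {#x#}) 1 * h x
        = Poly_Mapping.single m 1 * (Poly_Mapping.single (n - {#x#}) 1 * h x)"
      by (simp add: ac_simps)
  qed
  ultimately show ?thesis
    by (simp add: der_mono_def sum_mset_distrib_left sum_mset_distrib_right)
qed

lemma der_zero [simp]: "der h 0 = 0"
  by (simp add: der_def)

lemma der_single: "der h (Poly_Mapping.single m c) = pscale c (der_mono h m)"
  by (simp add: der_def)

lemma der_add: "der h (p + q) = der h p + der h q"
  by (simp add: der_def poly.lin_ext_add)

lemma der_mult: "der h (p * q) = der h p * q + p * der h q"
proof (induction p rule: poly_mapping_add_induct)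
  case (single m c)
  show ?case
  proof (induction q rule: poly_mapping_add_induct)
    case (single n d)
    have "Poly_Mapping.single k e = pscale e (Poly_Mapping.single k 1)" for k :: "'a multiset" and e :: 'b
      by simp
    note 1 = this[of m c] this[of n d]
    have "Poly_Mapping.single m c * der h (Poly_Mapping.single n d)
        = pscale (c * d) (Poly_Mapping.single m 1 * der_mono h n)"
      by (subst 1(1)) (simp add: der_single pscale_mult_left pscale_mult_right del: pscale_single)
    moreover have "der h (Poly_Mapping.single m c) * Poly_Mapping.single n d
        = pscale (c * d) (der_mono h m * Poly_Mapping.single n 1)"
      by (subst 1(2)) (simp add: der_single pscale_mult_left pscale_mult_right mult.commute del: pscale_single)
    ultimately show ?case
      by (simp add: mult_single der_single der_mono_plus poly.scale_right_distrib)
  next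
    case (add p q)
    then show ?case by (simp add: distrib_left der_add)
  qed
next
  case (add p q)
  then show ?case by (simp add: distrib_right der_add)
qed

lemma der_scale: "der h (pscale c p) = pscale c (der h p)"
  unfolding pscale_def by (simp add: der_mult der_single der_mono_def)

lemma derivation_der: "derivation (der h)"
  by (simp add: derivation_def der_add der_scale der_mult)

lemma der_var [simp]: "der h (var x) = h x"
  by (simp add: der_single der_mono_def)

lemma der_eqI: "derivation \<delta> \<Longrightarrow> (\<And>x. \<delta> (var x) = h x) \<Longrightarrow> \<delta> p = der h p"
  by (rule derivation_eqI) (simp_all add: derivation_der)

lemma der_plus_fun: "der (\<lambda>x. h x + g x) p = der h p + der g p"
  by (rule sym, rule der_eqI)
    (simp_all add: derivation_def der_add der_mult der_scale algebra_simps)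

lemma der_scale_fun: "der (\<lambda>x. pscale c (h x)) p = pscale c (der h p)"
  by (rule sym, rule der_eqI)
    (simp_all add: derivation_def der_add der_mult der_scale algebra_simps
      pscale_mult_left pscale_mult_right)

lemma der_zero_fun [simp]: "der (\<lambda>x. 0) p = 0"
  by (rule sym, rule der_eqI) (simp_all add: derivation_def)

text \<open>The bound is strict so that \<open>low 0\<close> is zero and inductions over the degree start trivially.\<close>

definition low :: "nat \<Rightarrow> ('x multiset \<Rightarrow>\<^sub>0 'k::field) set"
  where "low d = {p. \<forall>m\<in>Poly_Mapping.keys p. size m < d}"

lemma low_0: "p \<in> low 0 \<Longrightarrow> p = 0"
  by (rule poly_mapping_eqI) (simp add: low_def in_keys_iff)

lemma low_mono: "p \<in> low d \<Longrightarrow> d \<le> e \<Longrightarrow> p \<in> low e"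
  by (auto simp: low_def)

lemma ex_low: "\<exists>d. p \<in> low d"
proof -
  have "finite (size ` Poly_Mapping.keys p)" by simp
  then obtain d where "\<forall>n\<in>size ` Poly_Mapping.keys p. n < d"
    using finite_nat_set_iff_bounded by blast
  then show ?thesis by (auto simp: low_def)
qed

lemma low_zero [simp]: "0 \<in> low d"
  by (simp add: low_def)

lemma low_single: "size m < d \<Longrightarrow> Poly_Mapping.single m c \<in> low d"
  by (auto simp: low_def split: if_splits)

lemma low_add: "p \<in> low d \<Longrightarrow> q \<in> low d \<Longrightarrow> p + q \<in> low d"
  using keys_add[of p q] by (auto simp: low_def)

text \<open>Degree at most \<open>e\<close> times degree below \<open>d\<close>: the uneven bounds
  keep the result strict without truncated subtraction.\<close>

lemma low_mult: "p \<in> low (Suc e) \<Longrightarrow> q \<in> low d \<Longrightarrow> p * q \<in> low (e + d)"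
  using keys_mult[of p q] by (fastforce simp: low_def)

lemma low_pscale: "p \<in> low d \<Longrightarrow> pscale c p \<in> low d"
  using low_mult[of "Poly_Mapping.single 0 c" 0 p d] low_single[of 0 1 c] by (simp add: pscale_def)

lemma low_diff: "p \<in> low d \<Longrightarrow> q \<in> low d \<Longrightarrow> p - q \<in> low d"
  using low_add[of p d "pscale (-1) q"] low_pscale[of q d "-1"] by simp

lemma low_sum: "(\<And>i. i \<in> S \<Longrightarrow> f i \<in> low d) \<Longrightarrow> sum f S \<in> low d"
  by (induction S rule: infinite_finite_induct) (auto intro: low_add)

lemma low_der_mono:
  assumes "\<And>x. h x \<in> low 2"
  shows "der_mono h m \<in> low (Suc (size m))"
proof -
  \<comment> \<open>The \<open>m\<close> in the summands stays fixed; only the index multiset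
    \<open>n\<close> shrinks. Each term trades one variable for a polynomial of degree at most
    one.\<close>
  have "(\<Sum>x\<in>#n. Poly_Mapping.single (m - {#x#}) 1 * h x) \<in> low (Suc (size m))" if "n \<subseteq># m" for n
    using that
  proof (induction n)
    case (add x n)
    then have x: "x \<in># m" and n: "n \<subseteq># m" by (auto dest: mset_subset_eq_insertD)
    have "Poly_Mapping.single (m - {#x#}) 1 * h x \<in> low (size (m - {#x#}) + 2)"
      by (intro low_mult assms low_single) simp
    moreover have "size (m - {#x#}) + 2 = Suc (size m)"
      using x by (metis Suc_eq_plus1 add_2_eq_Suc' insert_DiffM size_add_mset)
    ultimately show ?case using add.IH[OF n] by (simp add: low_add)
  qed simp
  then show ?thesis by (simp add: der_mono_def)
qed

lemma low_der:
  assumes "\<And>x. h x \<in> low 2" and "p \<in> low d"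
  shows "der h p \<in> low d"
  unfolding der_def lin_ext_def
proof (intro low_sum low_pscale)
  fix m assume "m \<in> Poly_Mapping.keys p"
  then have "Suc (size m) \<le> d" using assms(2) by (auto simp: low_def)
  then show "der_mono h m \<in> low d" using low_der_mono[of h m] assms(1) low_mono by blast
qed

section \<open>Commuting elements modulo an ideal\<close>

definition (in unital_algebra) two_sided_ideal :: "'a set \<Rightarrow> bool"
  where "two_sided_ideal I \<longleftrightarrow> subspace I \<and> (\<forall>x\<in>I. \<forall>a. a * x \<in> I \<and> x * a \<in> I)"

text \<open>
  \<open>\<iota> x\<close> is the class of \<open>x\<close> in \<open>A/I\<close>, expanded in a basis whose elements serve as variables; the last
  axiom says so without mentioning the basis. Variables outside the basis never occur in \<open>\<iota> x\<close>.
\<close>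

locale symbol_map = unital_algebra scale for scale :: "'k::field \<Rightarrow> 'a::ring_1 \<Rightarrow> 'a" +
  fixes I :: "'a set" and \<iota> :: "'a \<Rightarrow> ('a multiset \<Rightarrow>\<^sub>0 'k)"
  assumes ideal: "two_sided_ideal I"
    and \<iota>_add: "\<iota> (x + y) = \<iota> x + \<iota> y"
    and \<iota>_scale: "\<iota> (scale c x) = pscale c (\<iota> x)"
    and \<iota>_ideal: "x \<in> I \<Longrightarrow> \<iota> x = 0"
    and \<iota>_low: "\<iota> x \<in> low 2"
    and der_\<iota>: "(\<And>x y. h (x + y) = h x + h y) \<Longrightarrow> (\<And>c x. h (scale c x) = pscale c (h x))
      \<Longrightarrow> (\<And>x. x \<in> I \<Longrightarrow> h x = 0) \<Longrightarrow> der h (\<iota> x) = h x"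
begin

lemma \<iota>_diff: "\<iota> (x - y) = \<iota> x - \<iota> y"
  using \<iota>_add[of "x - y" y] by (simp add: algebra_simps)

lemma ideal_mult: "x \<in> I \<Longrightarrow> a * x \<in> I" "x \<in> I \<Longrightarrow> x * a \<in> I"
  using ideal by (auto simp: two_sided_ideal_def)

section \<open>The multiplication operators on the symmetric algebra\<close>

definition lmult_der :: "'a \<Rightarrow> ('a multiset \<Rightarrow>\<^sub>0 'k) \<Rightarrow> ('a multiset \<Rightarrow>\<^sub>0 'k)"
  where "lmult_der a = der (\<lambda>x. \<iota> (a * x))"

definition rmult_der :: "'a \<Rightarrow> ('a multiset \<Rightarrow>\<^sub>0 'k) \<Rightarrow> ('a multiset \<Rightarrow>\<^sub>0 'k)"
  where "rmult_der a = der (\<lambda>x. \<iota> (x * a))"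

text \<open>\<open>der_\<iota>\<close> applies because the map from \<open>x\<close> to
  \<open>\<iota> (a * x)\<close> is linear and, \<open>I\<close> being an ideal, vanishes on
  \<open>I\<close>.\<close>

lemma lmult_der_\<iota> [simp]: "lmult_der a (\<iota> x) = \<iota> (a * x)"
  unfolding lmult_der_def
  by (rule der_\<iota>) (simp_all add: distrib_left \<iota>_add scale_mult_right \<iota>_scale \<iota>_ideal ideal_mult)

lemma rmult_der_\<iota> [simp]: "rmult_der a (\<iota> x) = \<iota> (x * a)"
  unfolding rmult_der_def
  by (rule der_\<iota>) (simp_all add: distrib_right \<iota>_add scale_mult_left \<iota>_scale \<iota>_ideal ideal_mult)

lemma lmult_der_var [simp]: "lmult_der a (var x) = \<iota> (a * x)"
  by (simp add: lmult_der_def)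

lemma rmult_der_var [simp]: "rmult_der a (var x) = \<iota> (x * a)"
  by (simp add: rmult_der_def)

lemma derivation_mult_der: "derivation (lmult_der a)" "derivation (rmult_der a)"
  by (simp_all add: lmult_der_def rmult_der_def derivation_der)

lemmas mult_der_simps =
  derivation_mult_der[unfolded derivation_def, THEN conjunct1, rule_format]
  derivation_mult_der[unfolded derivation_def, THEN conjunct2, THEN conjunct1, rule_format]
  derivation_mult_der[unfolded derivation_def, THEN conjunct2, THEN conjunct2, rule_format]

lemma lmult_der_commutator:
  "lmult_der (commutator a b) p = lmult_der a (lmult_der b p) - lmult_der b (lmult_der a p)"
  by (rule derivation_eqI[OF derivation_mult_der(1)
        derivation_commutator[OF derivation_mult_der(1,1)]])
    (simp add: commutator_def left_diff_distrib \<iota>_diff mult.assoc)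

text \<open>The commutator of the two operators is a derivation sending \<open>var x\<close> to the
  class of \<open>x * (b * a - a * b)\<close>, an element of \<open>I\<close>.\<close>

lemma rmult_der_commute:
  assumes "commutator a b \<in> I"
  shows "rmult_der a (rmult_der b p) = rmult_der b (rmult_der a p)"
proof -
  have "rmult_der a (rmult_der b p) - rmult_der b (rmult_der a p) = der (\<lambda>x. 0) p"
  proof (rule der_eqI)
    fix x
    have "\<iota> (x * b * a - x * a * b) = 0"
    proof (rule \<iota>_ideal)
      have "x * b * a - x * a * b = (- x) * commutator a b"
        by (simp add: commutator_def algebra_simps)
      then show "x * b * a - x * a * b \<in> I" using ideal_mult(1)[OF assms, of "- x"] by simp
    qed
    then show "rmult_der a (rmult_der b (var x)) - rmult_der b (rmult_der a (var x)) = 0"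
      by (simp add: \<iota>_diff)
  qed (intro derivation_commutator derivation_mult_der)
  then show ?thesis by simp
qed

lemma lmult_rmult_der_commute: "lmult_der a (rmult_der b p) = rmult_der b (lmult_der a p)"
proof -
  have "lmult_der a (rmult_der b p) - rmult_der b (lmult_der a p) = der (\<lambda>x. 0) p"
    by (rule der_eqI) (simp_all add: derivation_commutator derivation_mult_der mult.assoc)
  then show ?thesis by simp
qed

text \<open>
  If \<open>U(A/I)\<close> is identified with the symmetric algebra by sending \<open>u\<close> to the image of \<open>1\<close> under
  \<open>u\<close>, these are left and right multiplication by \<open>a\<close>.
\<close>

definition lop :: "'a \<Rightarrow> ('a multiset \<Rightarrow>\<^sub>0 'k) \<Rightarrow> ('a multiset \<Rightarrow>\<^sub>0 'k)"
  where "lop a p = \<iota> a * p + lmult_der a p"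

definition rop :: "'a \<Rightarrow> ('a multiset \<Rightarrow>\<^sub>0 'k) \<Rightarrow> ('a multiset \<Rightarrow>\<^sub>0 'k)"
  where "rop a p = \<iota> a * p + rmult_der a p"

lemma rop_add: "rop a (p + q) = rop a p + rop a q"
  by (simp add: rop_def mult_der_simps algebra_simps)

lemma rop_scale: "rop a (pscale c p) = pscale c (rop a p)"
  by (simp add: rop_def mult_der_simps pscale_mult_right poly.scale_right_distrib)

lemma rop_zero [simp]: "rop a 0 = 0"
  using rop_add[of a 0 0] by simp

lemma lop_add: "lop a (p + q) = lop a p + lop a q"
  by (simp add: lop_def mult_der_simps algebra_simps)

lemma lop_zero [simp]: "lop a 0 = 0"
  using lop_add[of a 0 0] by simp

lemma lop_sum: "lop a (sum f S) = (\<Sum>i\<in>S. lop a (f i))"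
  by (induction S rule: infinite_finite_induct) (simp_all add: lop_add)

text \<open>The Leibniz rule produces the extra term \<open>\<iota> (a * b) * p\<close> on either
  side: from \<open>lmult_der a\<close> meeting \<open>\<iota> b\<close>, and from
  \<open>rmult_der b\<close> meeting \<open>\<iota> a\<close>.\<close>

lemma lop_rop_commute: "lop a (rop b p) = rop b (lop a p)"
  by (simp add: lop_def rop_def mult_der_simps lmult_rmult_der_commute algebra_simps)

lemma rop_commute:
  assumes "commutator a b \<in> I"
  shows "rop a (rop b p) = rop b (rop a p)"
proof -
  have "\<iota> (b * a) = \<iota> (a * b)"
    using \<iota>_ideal[OF assms] by (simp add: commutator_def \<iota>_diff)
  then show ?thesis
    using rmult_der_commute[OF assms] by (simp add: rop_def mult_der_simps algebra_simps)
qed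

text \<open>In the bracket law the Leibniz terms leave
  \<open>\<iota> (a * b) * p - \<iota> (b * a) * p\<close>, which is the multiplication part of
  \<open>lop (commutator a b)\<close>.\<close>

lemma lie_module_lop: "lie_module pscale scale commutator lop"
proof
  show "lop (commutator a b) p = lop a (lop b p) - lop b (lop a p)" for a b p
    by (simp add: lop_def mult_der_simps lmult_der_commutator algebra_simps)
      (simp add: commutator_def \<iota>_diff algebra_simps)
  show "lop (a + b) p = lop a p + lop b p" for a b p
    by (simp add: lop_def lmult_der_def distrib_right \<iota>_add der_plus_fun algebra_simps)
  show "lop (scale c a) p = pscale c (lop a p)" for a c p
    by (simp add: lop_def lmult_der_def scale_mult_left \<iota>_scale der_scale_fun pscale_mult_left
        poly.scale_right_distrib)
  show "lop a (pscale c p) = pscale c (lop a p)" for a c p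
    by (simp add: lop_def mult_der_simps pscale_mult_right poly.scale_right_distrib)
qed (rule lop_add)

text \<open>The counterpart of a Poincare-Birkhoff-Witt monomial: factors in \<open>C\<close> act as
  operators on the monomial of the remaining variables. Folding asks for operators that commute at
  all indices; those in \<open>C\<close> do, and \<open>id\<close> elsewhere completes the
  family.\<close>

definition rop_prod :: "'a set \<Rightarrow> 'a multiset \<Rightarrow> ('a multiset \<Rightarrow>\<^sub>0 'k)"
  where "rop_prod C m = fold_mset (\<lambda>c. if c \<in> C then rop c else id)
    (Poly_Mapping.single (filter_mset (\<lambda>x. x \<notin> C) m) 1) (filter_mset (\<lambda>x. x \<in> C) m)"

context
  fixes C
  assumes comm: "\<And>a b. a \<in> C \<Longrightarrow> b \<in> C \<Longrightarrow> commutator a b \<in> I"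
    and \<iota>_C: "\<And>c. c \<in> C \<Longrightarrow> \<iota> c = var c"
begin

interpretation comp_fun_commute "\<lambda>c. if c \<in> C then rop c else id"
  by unfold_locales (auto simp: fun_eq_iff rop_commute comm)

lemma rop_prod_add_mset: "c \<in> C \<Longrightarrow> rop_prod C (add_mset c m) = rop c (rop_prod C m)"
  by (simp add: rop_prod_def)

lemma rop_prod_outside: "set_mset m \<inter> C = {} \<Longrightarrow> rop_prod C m = Poly_Mapping.single m 1"
proof -
  assume "set_mset m \<inter> C = {}"
  then have "filter_mset (\<lambda>x. x \<in> C) m = {#}" "filter_mset (\<lambda>x. x \<notin> C) m = m"
    by (auto simp: multiset_eq_iff not_in_iff)
  then show ?thesis by (simp only: rop_prod_def fold_mset_empty)
qed

text \<open>\<open>rop c\<close> is multiplication by \<open>var c\<close> plus a derivation that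
  does not raise the degree, so only the product of the variables reaches the top degree.\<close>

lemma rop_prod_leading: "rop_prod C m - Poly_Mapping.single m 1 \<in> low (size m)"
proof -
  have leading: "rop_prod C (n + k) - Poly_Mapping.single (n + k) 1 \<in> low (size (n + k))"
    if "set_mset n \<inter> C = {}" "set_mset k \<subseteq> C" for n k
    using that
  proof (induction k)
    case empty
    then show ?case by (simp add: rop_prod_outside)
  next
    case (add c k)
    let ?m = "n + k" and ?d = "size (n + k)"
    have c: "c \<in> C" and IH: "rop_prod C ?m - Poly_Mapping.single ?m 1 \<in> low ?d"
      using add by auto
    have "(rop_prod C ?m - Poly_Mapping.single ?m 1) + Poly_Mapping.single ?m 1 \<in> low (Suc ?d)"
      by (intro low_add low_mono[OF IH] low_single) simp_all
    then have "rmult_der c (rop_prod C ?m) \<in> low (Suc ?d)"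
      unfolding rmult_der_def by (intro low_der \<iota>_low) simp
    moreover have "var c * (rop_prod C ?m - Poly_Mapping.single ?m 1) \<in> low (1 + ?d)"
      by (intro low_mult low_single IH) simp
    moreover have "rop_prod C (n + add_mset c k) - Poly_Mapping.single (n + add_mset c k) 1
        = var c * (rop_prod C ?m - Poly_Mapping.single ?m 1) + rmult_der c (rop_prod C ?m)"
      by (simp add: rop_prod_add_mset c rop_def \<iota>_C right_diff_distrib mult_single)
    ultimately show ?case by (simp add: low_add)
  qed
  have m: "filter_mset (\<lambda>x. x \<notin> C) m + filter_mset (\<lambda>x. x \<in> C) m = m"
    by (metis add.commute multiset_partition)
  have "set_mset (filter_mset (\<lambda>x. x \<notin> C) m) \<inter> C = {}" "set_mset (filter_mset (\<lambda>x. x \<in> C) m) \<subseteq> C"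
    by auto
  from leading[OF this] show ?thesis by (simp only: m)
qed

text \<open>
  Being unitriangular for the degree filtration, this map is bijective; it turns multiplication by
  the variables in \<open>C\<close> into the operators \<open>rop c\<close>.
\<close>

definition rop_ext :: "('a multiset \<Rightarrow>\<^sub>0 'k) \<Rightarrow> ('a multiset \<Rightarrow>\<^sub>0 'k)"
  where "rop_ext p = lin_ext pscale (rop_prod C) p"

lemma rop_ext_add: "rop_ext (p + q) = rop_ext p + rop_ext q"
  by (simp add: rop_ext_def poly.lin_ext_add)

lemma rop_ext_zero: "rop_ext 0 = 0"
  by (simp add: rop_ext_def)

lemma rop_ext_diff: "rop_ext (p - q) = rop_ext p - rop_ext q"
  by (simp add: rop_ext_def poly.lin_ext_diff)

lemma rop_ext_single: "rop_ext (Poly_Mapping.single m c) = pscale c (rop_prod C m)"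
  by (simp add: rop_ext_def)

lemma rop_ext_var_mult:
  assumes "c \<in> C"
  shows "rop_ext (var c * p) = rop c (rop_ext p)"
  by (induction p rule: poly_mapping_add_induct)
    (simp_all add: mult_single rop_ext_single rop_prod_add_mset assms rop_scale distrib_left
      rop_ext_add rop_add)

lemma rop_ext_leading:
  assumes "p \<in> low (Suc d)"
  shows "rop_ext p - p \<in> low d"
proof -
  have "p = (\<Sum>m\<in>Poly_Mapping.keys p. Poly_Mapping.single m (Poly_Mapping.lookup p m))"
    by (rule poly_mapping_eqI) (simp add: lookup_sum lookup_single when_def in_keys_iff)
  then have "rop_ext p - p = (\<Sum>m\<in>Poly_Mapping.keys p. pscale (Poly_Mapping.lookup p m) (rop_prod C m))
      - (\<Sum>m\<in>Poly_Mapping.keys p. pscale (Poly_Mapping.lookup p m) (Poly_Mapping.single m 1))"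
    by (simp add: rop_ext_def lin_ext_def)
  also have "\<dots> = (\<Sum>m\<in>Poly_Mapping.keys p.
      pscale (Poly_Mapping.lookup p m) (rop_prod C m - Poly_Mapping.single m 1))"
    by (simp add: sum_subtractf poly.scale_right_diff_distrib del: pscale_single)
  also have "\<dots> \<in> low d"
    using assms
    by (intro low_sum low_pscale low_mono[OF rop_prod_leading]) (auto simp: low_def)
  finally show ?thesis .
qed

text \<open>If the image is zero, \<open>p\<close> is up to sign its own lower-order error, so its
  degree bound descends to \<open>low 0\<close>.\<close>

lemma rop_ext_inj:
  assumes "rop_ext p = 0"
  shows "p = 0"
proof -
  have "p \<in> low d \<Longrightarrow> p = 0" for d
  proof (induction d)
    case (Suc d)
    from low_diff[OF low_zero rop_ext_leading[OF Suc.prems]] show ?case using Suc.IH by (simp add: assms)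
  qed (rule low_0)
  then show ?thesis using ex_low by blast
qed

lemma rop_ext_surj: "\<exists>q. rop_ext q = p"
proof -
  have "p \<in> low d \<Longrightarrow> \<exists>q. rop_ext q = p" for d p
  proof (induction d arbitrary: p)
    case 0
    then show ?case by (auto dest!: low_0 simp: rop_ext_def intro!: exI[of _ 0])
  next
    case (Suc d)
    from rop_ext_leading[OF Suc.prems] Suc.IH obtain q where "rop_ext q = rop_ext p - p" by blast
    then have "rop_ext (p - q) = p" by (simp add: rop_ext_diff)
    then show ?case by blast
  qed
  then show ?thesis using ex_low by blast
qed

text \<open>\<open>rop_ext\<close> fixes \<open>var x\<close> since \<open>x\<close> lies outside
  \<open>C\<close>. Pulled back along this bijection, the equation would put \<open>var x\<close>
  into the ideal generated by the variables in \<open>D\<close>, which the coefficient at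
  \<open>{#x#}\<close> excludes.\<close>

lemma var_notin_rop_image:
  assumes "x \<notin> C" and "D \<subseteq> C" "finite D"
  shows "var x \<noteq> (\<Sum>c\<in>D. rop c (f c))"
proof
  assume eq: "var x = (\<Sum>c\<in>D. rop c (f c))"
  obtain g where g: "\<And>p. rop_ext (g p) = p" using rop_ext_surj by metis
  have sum: "rop_ext (sum q D) = (\<Sum>c\<in>D. rop_ext (q c))" for q
    using \<open>finite D\<close> by induction (simp_all add: rop_ext_add rop_ext_zero)
  have "rop_ext (var x) = var x"
    using \<open>x \<notin> C\<close> by (simp add: rop_ext_single rop_prod_outside)
  also have "\<dots> = rop_ext (\<Sum>c\<in>D. var c * g (f c))"
    unfolding eq sum using \<open>D \<subseteq> C\<close> by (intro sum.cong) (auto simp: rop_ext_var_mult g)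
  finally have "rop_ext (var x - (\<Sum>c\<in>D. var c * g (f c))) = 0"
    by (simp add: rop_ext_diff)
  then have "var x = (\<Sum>c\<in>D. var c * g (f c))"
    by (auto dest: rop_ext_inj)
  then have "Poly_Mapping.lookup (\<Sum>c\<in>D. var c * g (f c)) {#x#} = (1::'k)"
    by (metis lookup_single_eq)
  then have "(\<Sum>c\<in>D. Poly_Mapping.lookup (var c * g (f c)) {#x#}) \<noteq> (0::'k)"
    by (simp add: lookup_sum)
  then obtain c where c: "c \<in> D" "{#x#} \<in> Poly_Mapping.keys (var c * g (f c))"
    by (metis (no_types, lifting) in_keys_iff sum.neutral)
  then obtain m where "{#x#} = {#c#} + m"
    using keys_mult[of "var c" "g (f c)"] by auto
  then have "x = c" by (auto simp: single_is_union)
  with c assms show False by blast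
qed

end

end

section \<open>Commutative subspaces modulo an ideal are finite-dimensional\<close>

context unital_algebra
begin

text \<open>A basis of \<open>I\<close> is enlarged by the \<open>c n\<close>, which independence
  modulo \<open>I\<close> permits, and then to a basis of A. \<open>\<iota>\<close> kills the first
  part and sends every other basis element to its own variable.\<close>

lemma symbol_map_exists:
  assumes I: "two_sided_ideal I" and c: "\<And>n. c n \<notin> span (c ` {..<n} \<union> I)"
  shows "\<exists>\<iota>. symbol_map scale I \<iota> \<and> (\<forall>n::nat. \<iota> (c n) = var (c n))"
proof -
  interpret vp: vector_space_pair scale "pscale :: 'k \<Rightarrow> ('a multiset \<Rightarrow>\<^sub>0 'k) \<Rightarrow> ('a multiset \<Rightarrow>\<^sub>0 'k)"
    by (simp add: vector_space_pair_def vector_space_axioms poly.vector_space_axioms)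
  have subI: "subspace I" using I by (simp add: two_sided_ideal_def)
  obtain B where B: "B \<subseteq> I" "independent B" "I \<subseteq> span B"
    using maximal_independent_subset by blast
  have spanB: "span B = I"
    using span_minimal[OF B(1) subI] B(3) by blast
  have sup: "span (c ` {..<n} \<union> B) \<subseteq> span (c ` {..<n} \<union> I)" for n
    by (rule span_mono) (use B in auto)
  have "independent (c ` {..<n} \<union> B)" for n
  proof (induction n)
    case (Suc n)
    have "c n \<notin> span (c ` {..<n} \<union> B)" using c sup by blast
    from independent_insertI[OF this Suc] show ?case
      by (simp add: lessThan_Suc)
  qed (use B in simp)
  moreover have "c ` {..<m} \<union> B \<subseteq> c ` {..<n} \<union> B \<or> c ` {..<n} \<union> B \<subseteq> c ` {..<m} \<union> B" for m n
    using linear[of m n] by auto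
  ultimately have "independent (\<Union> (range (\<lambda>n. c ` {..<n} \<union> B)))"
    by (intro independent_Union_directed) blast+
  moreover have "\<Union> (range (\<lambda>n. c ` {..<n} \<union> B)) = range c \<union> B"
    by auto
  ultimately have ind: "independent (range c \<union> B)" by simp
  define E where "E = extend_basis (range c \<union> B)"
  have E: "independent E" "span E = UNIV" "range c \<union> B \<subseteq> E"
    using independent_extend_basis[OF ind] span_extend_basis[OF ind] extend_basis_superset[OF ind]
    by (auto simp: E_def)
  define \<iota> where "\<iota> = vp.construct E (\<lambda>b. if b \<in> B then 0 else var b)"
  have lin: "Vector_Spaces.linear scale pscale \<iota>"
    unfolding \<iota>_def by (rule vp.linear_construct[OF E(1)])
  have base: "\<iota> b = (if b \<in> B then 0 else var b)" if "b \<in> E" for b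
    unfolding \<iota>_def using vp.construct_basis[OF E(1) that] by simp
  have "c n \<notin> I" for n using c[of n] by (auto simp: span_base)
  then have "\<iota> (c n) = var (c n)" for n
    using base[of "c n"] E(3) B(1) by (metis UnCI rangeI subsetD)
  moreover have "symbol_map scale I \<iota>"
  proof
    show "two_sided_ideal I" by (rule I)
    show "\<iota> (x + y) = \<iota> x + \<iota> y" for x y by (rule vp.linear_add[OF lin])
    show "\<iota> (scale a x) = pscale a (\<iota> x)" for a x by (rule vp.linear_scale[OF lin])
    show "\<iota> x = 0" if "x \<in> I" for x
    proof (rule vp.linear_eq_on[OF lin vp.linear_zero])
      show "x \<in> span B" using that spanB by simp
    qed (use base E(3) in auto)
    show "\<iota> x \<in> low 2" for x
    proof -
      have "poly.subspace (low 2 :: ('a multiset \<Rightarrow>\<^sub>0 'k) set)"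
        by (intro poly.subspaceI low_zero low_add low_pscale)
      moreover have "(\<lambda>b. if b \<in> B then 0 else var b) ` E \<subseteq> (low 2 :: ('a multiset \<Rightarrow>\<^sub>0 'k) set)"
        by (auto intro: low_single)
      ultimately show ?thesis
        using vp.construct_in_span[OF E(1)] poly.span_minimal unfolding \<iota>_def by blast
    qed
    show "der h (\<iota> x) = h x"
      if h: "\<And>x y. h (x + y) = h x + h y" "\<And>c x. h (scale c x) = pscale c (h x)"
        "\<And>x. x \<in> I \<Longrightarrow> h x = 0" for h x
    proof (rule vp.linear_eq_on)
      show "Vector_Spaces.linear scale pscale h"
        by unfold_locales (auto simp: h)
      show "Vector_Spaces.linear scale pscale (\<lambda>x. der h (\<iota> x))"
        by unfold_locales
          (auto simp: vp.linear_add[OF lin] vp.linear_scale[OF lin] der_add der_scale)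
      show "x \<in> span E" using E by simp
      show "der h (\<iota> b) = h b" if "b \<in> E" for b
        using base[OF that] h(3) B(1) by auto
    qed
  qed
  ultimately show ?thesis by blast
qed

theorem commuting_sequence_dependent:
  assumes noeth: "left_noetherian (universal_enveloping_algebra scale commutator)"
    and I: "two_sided_ideal I" and comm: "\<And>i j :: nat. commutator (c i) (c j) \<in> I"
  shows "\<exists>n. c n \<in> span (c ` {..<n} \<union> I)"
proof (rule ccontr)
  assume "\<not> ?thesis"
  then have notin: "c n \<notin> span (c ` {..<n} \<union> I)" for n by blast
  with I obtain \<iota> where "symbol_map scale I \<iota>" and \<iota>_c: "\<And>n. \<iota> (c n) = var (c n)"
    using symbol_map_exists by blast
  then interpret symbol_map scale I \<iota> by simp
  interpret lie_module pscale scale commutator lop by (rule lie_module_lop)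
  \<comment> \<open>The sum of the images of \<open>rop (c i)\<close> for \<open>i < n\<close>; it
    is stable under \<open>lop\<close> because the two families commute.\<close>
  define W where "W n = {\<Sum>x\<in>c ` {..<n}. rop x (f x) |f. True}" for n
  have W_I: "(\<Sum>x\<in>c ` {..<n}. rop x (f x)) \<in> W n" for f n
    by (auto simp: W_def)
  have sub: "poly.subspace (W n)" for n
  proof (rule poly.subspaceI)
    show "0 \<in> W n" using W_I[where f="\<lambda>_. 0"] by simp
    fix p q a assume "p \<in> W n" "q \<in> W n"
    then obtain f g where fg: "p = (\<Sum>x\<in>c ` {..<n}. rop x (f x))" "q = (\<Sum>x\<in>c ` {..<n}. rop x (g x))"
      by (auto simp: W_def)
    show "p + q \<in> W n"
      using W_I[where f="\<lambda>x. f x + g x"] by (simp add: fg rop_add sum.distrib)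
    show "pscale a p \<in> W n"
      using W_I[where f="\<lambda>x. pscale a (f x)"] by (simp add: fg rop_scale poly.scale_sum_right)
  qed
  have inv: "lop a p \<in> W n" if "p \<in> W n" for n a p
  proof -
    from that obtain f where "p = (\<Sum>x\<in>c ` {..<n}. rop x (f x))" by (auto simp: W_def)
    then show ?thesis using W_I[where f="\<lambda>x. lop a (f x)"] by (simp add: lop_sum lop_rop_commute)
  qed
  have single: "rop (c i) p \<in> W n" if "i < n" for i n p
  proof -
    let ?f = "\<lambda>x. if x = c i then p else 0"
    have "(\<Sum>x\<in>c ` {..<n}. rop x (?f x)) = (\<Sum>x\<in>{c i}. rop x p)"
      using that by (intro sum.mono_neutral_cong_right) auto
    then have "(\<Sum>x\<in>c ` {..<n}. rop x (?f x)) = rop (c i) p" by simp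
    moreover have "(\<Sum>x\<in>c ` {..<n}. rop x (?f x)) \<in> W n" by (rule W_I)
    ultimately show ?thesis by (simp only:)
  qed
  have mono: "W n \<subseteq> W (Suc n)" for n
  proof
    fix p assume "p \<in> W n"
    then obtain f where "p = (\<Sum>x\<in>c ` {..<n}. rop x (f x))" by (auto simp: W_def)
    also have "\<dots> \<in> W (Suc n)"
      by (rule poly.subspace_sum[OF sub]) (auto intro: single)
    finally show "p \<in> W (Suc n)" .
  qed
  \<comment> \<open>At the vector 1 the operators \<open>lop (c N)\<close> and
    \<open>rop (c N)\<close> agree: the second shows membership in \<open>W (Suc N)\<close>, the
    first lets stability bring it down to \<open>W N\<close>.\<close>
  obtain N where N: "\<And>n a. n \<ge> N \<Longrightarrow> lop a 1 \<in> W n \<Longrightarrow> lop a 1 \<in> W N"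
    using left_noetherian_stabilizes[of W 1, OF noeth sub inv mono] by blast
  have one: "der h 1 = 0" for h
    using der_mult[of h 1 1] by simp
  have "lop (c N) 1 = var (c N)" "rop (c N) 1 = var (c N)"
    by (simp_all add: lop_def rop_def lmult_der_def rmult_der_def one \<iota>_c)
  with single[of N "Suc N" 1] N[of "Suc N" "c N"] have "var (c N) \<in> W N" by simp
  then obtain f where "var (c N) = (\<Sum>x\<in>c ` {..<N}. rop x (f x))" by (auto simp: W_def)
  moreover have "c N \<notin> c ` {..<N}"
    using notin[of N] by (auto simp: span_base)
  ultimately show False
    using var_notin_rop_image[of "c ` {..<N}" "c N" "c ` {..<N}" f] comm \<iota>_c by auto
qed

end

section \<open>Algebras with chain conditions\<close>

lemma maximal_of_acc:
  assumes acc: "\<And>J :: nat \<Rightarrow> 'x set. (\<And>n. P (J n)) \<Longrightarrow> (\<And>n. J n \<subseteq> J (Suc n)) \<Longrightarrow> \<exists>N. \<forall>n\<ge>N. J n = J N"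
    and "J0 \<in> S" and S: "\<And>J. J \<in> S \<Longrightarrow> P J"
  shows "\<exists>M\<in>S. \<forall>J\<in>S. M \<subseteq> J \<longrightarrow> J = M"
proof (rule ccontr)
  assume "\<not> ?thesis"
  then have "\<forall>M. \<exists>J. M \<in> S \<longrightarrow> J \<in> S \<and> M \<subset> J" by blast
  then obtain f where f: "\<And>M. M \<in> S \<Longrightarrow> f M \<in> S \<and> M \<subset> f M" by metis
  define J where "J n = (f ^^ n) J0" for n
  have J: "J n \<in> S" for n
    by (induction n) (simp_all add: J_def f \<open>J0 \<in> S\<close>)
  have step: "J n \<subset> J (Suc n)" for n
    using f[OF J, of n] by (simp add: J_def)
  have "\<exists>N. \<forall>n\<ge>N. J n = J N"
    by (rule acc) (use J S step in auto)
  then obtain N where "J (Suc N) = J N" by (meson le_SucI order_refl)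
  with step[of N] show False by simp
qed

context unital_algebra
begin

definition left_ideal_of :: "'a set \<Rightarrow> bool"
  where "left_ideal_of J \<longleftrightarrow> subspace J \<and> (\<forall>x\<in>J. \<forall>a. a * x \<in> J)"

definition right_ideal_of :: "'a set \<Rightarrow> bool"
  where "right_ideal_of J \<longleftrightarrow> subspace J \<and> (\<forall>x\<in>J. \<forall>a. x * a \<in> J)"

definition findim_mod :: "'a set \<Rightarrow> 'a set \<Rightarrow> bool"
  where "findim_mod I S \<longleftrightarrow> (\<exists>F. finite F \<and> S \<subseteq> span (F \<union> I))"

lemma findim_mod_trans:
  assumes "findim_mod I S" and "T \<subseteq> span (S \<union> I)"
  shows "findim_mod I T"
proof -
  from assms(1) obtain F where F: "finite F" "S \<subseteq> span (F \<union> I)"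
    by (auto simp: findim_mod_def)
  have "span (S \<union> I) \<subseteq> span (F \<union> I)"
    by (rule span_minimal) (use F in \<open>auto intro: span_base\<close>)
  with F assms(2) show ?thesis by (auto simp: findim_mod_def)
qed

lemma findim_mod_Un:
  assumes "findim_mod I S" and "findim_mod I T"
  shows "findim_mod I (S \<union> T)"
proof -
  from assms obtain F G where "finite F" "S \<subseteq> span (F \<union> I)" "finite G" "T \<subseteq> span (G \<union> I)"
    by (auto simp: findim_mod_def)
  moreover have "span (F \<union> I) \<subseteq> span (F \<union> G \<union> I)" "span (G \<union> I) \<subseteq> span (F \<union> G \<union> I)"
    by (auto intro!: span_mono)
  ultimately show ?thesis
    unfolding findim_mod_def by (intro exI[of _ "F \<union> G"]) auto
qed

lemma findim_mod_finite: "finite F \<Longrightarrow> findim_mod I F"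
  by (auto simp: findim_mod_def intro: span_base)

lemma findim_mod_subset: "findim_mod I T \<Longrightarrow> S \<subseteq> T \<Longrightarrow> findim_mod I S"
  by (auto simp: findim_mod_def)

lemma findim_mod_ideal: "findim_mod I I"
  unfolding findim_mod_def by (intro exI[of _ "{}"]) (auto intro: span_base)

lemma lmult_span:
  assumes "x \<in> span T" and "\<And>y. y \<in> T \<Longrightarrow> a * y \<in> span Y"
  shows "a * x \<in> span Y"
  using assms(1)
proof (induction rule: span_induct_alt)
  case (step c x y)
  then show ?case using assms(2) by (simp add: distrib_left scale_mult_right span_add span_scale)
qed (simp add: span_zero)

lemma rmult_span:
  assumes "x \<in> span T" and "\<And>y. y \<in> T \<Longrightarrow> y * a \<in> span Y"
  shows "x * a \<in> span Y"
  using assms(1)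
proof (induction rule: span_induct_alt)
  case (step c x y)
  then show ?case using assms(2) by (simp add: distrib_right scale_mult_left span_add span_scale)
qed (simp add: span_zero)

text \<open>Coefficients belong to indices rather than to values of \<open>c\<close>, since families
  such as the powers of one element may repeat.\<close>

lemma span_Un_coeffs:
  assumes I: "subspace I" and "finite J" and "x \<in> span (c ` J \<union> I)"
  shows "\<exists>k. x - (\<Sum>j\<in>J. scale (k j) (c j)) \<in> I"
  using assms(2,3)
proof (induction J arbitrary: x)
  case empty
  then show ?case using span_eq_iff[THEN iffD2, OF I] by simp
next
  case (insert i J)
  then obtain r where "x - scale r (c i) \<in> span (c ` J \<union> I)"
    by (auto simp: span_breakdown_eq)
  with insert.IH obtain k where k: "x - scale r (c i) - (\<Sum>j\<in>J. scale (k j) (c j)) \<in> I" by blast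
  have "(\<Sum>j\<in>J. scale ((k(i := r)) j) (c j)) = (\<Sum>j\<in>J. scale (k j) (c j))"
    using insert.hyps by (intro sum.cong) auto
  then have "x - (\<Sum>j\<in>insert i J. scale ((k(i := r)) j) (c j)) \<in> I"
    using k insert.hyps by (simp add: algebra_simps)
  then show ?case by blast
qed

text \<open>Rank-nullity modulo \<open>I\<close>. Removing a spanning vector \<open>c\<close> from
  \<open>F\<close> costs at most one vector \<open>s0\<close>, whose image has a nonzero coefficient
  at \<open>c\<close>; subtracting a multiple of \<open>s0\<close> clears that coefficient
  elsewhere.\<close>

lemma findim_mod_kernel:
  assumes g: "\<And>x y. g (x + y) = g x + g y" "\<And>c x. g (scale c x) = scale c (g x)"
    and I: "subspace I" and S: "subspace S" and fin: "findim_mod I (g ` S)"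
  shows "\<exists>G. finite G \<and> S \<subseteq> span (G \<union> {s \<in> S. g s \<in> I})"
proof -
  have gd: "g (x - y) = g x - g y" for x y
    using g(1)[of "x - y" y] by (simp add: algebra_simps)
  from fin obtain F where "finite F" "g ` S \<subseteq> span (F \<union> I)" by (auto simp: findim_mod_def)
  then show ?thesis using S
  proof (induction F arbitrary: S)
    case empty
    then have "S \<subseteq> span ({} \<union> {s \<in> S. g s \<in> I})"
      using span_eq_iff[THEN iffD2, OF I] by (auto intro!: span_base)
    then show ?case by blast
  next
    case (insert c F)
    let ?S = "{s \<in> S. g s \<in> span (F \<union> I)}"
    have "subspace ?S"
      using g g(2)[of 0 0] insert.prems(2) unfolding subspace_def
      by (auto simp: span_add span_scale span_zero)
    with insert.IH[of ?S] obtain G where G: "finite G" "?S \<subseteq> span (G \<union> {s \<in> ?S. g s \<in> I})"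
      by blast
    have mono: "span (G \<union> {s \<in> ?S. g s \<in> I}) \<subseteq> span (insert s0 G \<union> {s \<in> S. g s \<in> I})" for s0
      by (rule span_mono) auto
    show ?case
    proof (cases "?S = S")
      case True
      then show ?thesis using G by (auto intro!: exI[of _ G])
    next
      case False
      then obtain s0 where s0: "s0 \<in> S" "g s0 \<notin> span (F \<union> I)" by blast
      have "g s0 \<in> span (insert c (F \<union> I))" using insert.prems(1) s0 by auto
      then obtain r where r: "g s0 - scale r c \<in> span (F \<union> I)" by (auto simp: span_breakdown_eq)
      with s0 have "r \<noteq> 0" by auto
      have "s \<in> span (insert s0 G \<union> {s \<in> S. g s \<in> I})" if "s \<in> S" for s
      proof -
        have "g s \<in> span (insert c (F \<union> I))" using insert.prems(1) that by auto
        then obtain q where q: "g s - scale q c \<in> span (F \<union> I)" by (auto simp: span_breakdown_eq)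
        have "g (s - scale (q / r) s0) = (g s - scale q c) - scale (q / r) (g s0 - scale r c)"
          using \<open>r \<noteq> 0\<close> by (simp add: gd g(2) scale_right_diff_distrib)
        also have "\<dots> \<in> span (F \<union> I)" by (intro span_diff span_scale q r)
        finally have "s - scale (q / r) s0 \<in> ?S"
          using that s0(1) insert.prems(2) by (simp add: subspace_diff subspace_scale)
        then have "s - scale (q / r) s0 \<in> span (insert s0 G \<union> {s \<in> S. g s \<in> I})"
          using G mono by blast
        moreover have "scale (q / r) s0 \<in> span (insert s0 G \<union> {s \<in> S. g s \<in> I})"
          by (intro span_scale span_base) simp
        ultimately show ?thesis using span_add by fastforce
      qed
      with G(1) show ?thesis by (intro exI[of _ "insert s0 G"]) auto
    qed
  qed
qed

end

text \<open>What is retained of a noetherian enveloping algebra; the structure theory of A rests on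
  these axioms. At the powers of one element the last of them says that A/I is algebraic.\<close>

locale acc_algebra = unital_algebra scale for scale :: "'k::field \<Rightarrow> 'a::ring_1 \<Rightarrow> 'a" +
  assumes left_acc: "(\<And>n. left_ideal_of (J n)) \<Longrightarrow> (\<And>n. J n \<subseteq> J (Suc n)) \<Longrightarrow> \<exists>N::nat. \<forall>n\<ge>N. J n = J N"
    and right_acc: "(\<And>n. right_ideal_of (J n)) \<Longrightarrow> (\<And>n. J n \<subseteq> J (Suc n)) \<Longrightarrow> \<exists>N::nat. \<forall>n\<ge>N. J n = J N"
    and commuting_dependent: "two_sided_ideal I \<Longrightarrow> (\<And>i j. commutator (c i) (c j) \<in> I)
      \<Longrightarrow> \<exists>n::nat. c n \<in> span (c ` {..<n} \<union> I)"

lemma (in acc_algebra) left_maximal: "J0 \<in> S \<Longrightarrow> (\<And>J. J \<in> S \<Longrightarrow> left_ideal_of J) \<Longrightarrow> \<exists>M\<in>S. \<forall>J\<in>S. M \<subseteq> J \<longrightarrow> J = M"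
  by (rule maximal_of_acc[of left_ideal_of]) (use left_acc in auto)

lemma (in acc_algebra) right_maximal: "J0 \<in> S \<Longrightarrow> (\<And>J. J \<in> S \<Longrightarrow> right_ideal_of J) \<Longrightarrow> \<exists>M\<in>S. \<forall>J\<in>S. M \<subseteq> J \<longrightarrow> J = M"
  by (rule maximal_of_acc[of right_ideal_of]) (use right_acc in auto)

section \<open>A maximal ideal of infinite codimension: primeness and an idempotent\<close>

locale just_infinite = acc_algebra scale for scale :: "'k::field \<Rightarrow> 'a::ring_1 \<Rightarrow> 'a" +
  fixes I :: "'a set"
  assumes ideal: "two_sided_ideal I" and infinite: "\<not> findim_mod I UNIV"
    and just: "two_sided_ideal J \<Longrightarrow> I \<subseteq> J \<Longrightarrow> J \<noteq> I \<Longrightarrow> findim_mod J UNIV"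
begin

lemma sub: "subspace I" and lI: "x \<in> I \<Longrightarrow> a * x \<in> I" and rI: "x \<in> I \<Longrightarrow> x * a \<in> I"
  using ideal by (auto simp: two_sided_ideal_def)

lemmas I_add = subspace_add[OF sub] and I_diff = subspace_diff[OF sub]
  and I_scale = subspace_scale[OF sub] and I_neg = subspace_neg[OF sub] and I_sum = subspace_sum[OF sub]

lemma I_zero [simp]: "0 \<in> I"
  by (rule subspace_0[OF sub])

lemma span_I [simp]: "span I = I"
  by (simp add: sub)

definition eqv :: "'a \<Rightarrow> 'a \<Rightarrow> bool" (infix \<open>\<approx>\<close> 50)
  where "x \<approx> y \<longleftrightarrow> x - y \<in> I"

lemma eqv_refl [simp]: "x \<approx> x"
  by (simp add: eqv_def)

lemma eqv_sym: "x \<approx> y \<Longrightarrow> y \<approx> x"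
  unfolding eqv_def using I_neg by fastforce

lemma eqv_trans [trans]: "x \<approx> y \<Longrightarrow> y \<approx> z \<Longrightarrow> x \<approx> z"
  unfolding eqv_def using I_add by fastforce

lemma eqv_add: "x \<approx> y \<Longrightarrow> u \<approx> v \<Longrightarrow> x + u \<approx> y + v"
  unfolding eqv_def using I_add[of "x - y" "u - v"] by (simp add: algebra_simps)

lemma eqv_diff: "x \<approx> y \<Longrightarrow> u \<approx> v \<Longrightarrow> x - u \<approx> y - v"
  unfolding eqv_def using I_diff[of "x - y" "u - v"] by (simp add: algebra_simps)

lemma eqv_lmult: "x \<approx> y \<Longrightarrow> a * x \<approx> a * y"
  unfolding eqv_def using lI[of "x - y" a] by (simp add: algebra_simps)

lemma eqv_rmult: "x \<approx> y \<Longrightarrow> x * a \<approx> y * a"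
  unfolding eqv_def using rI[of "x - y" a] by (simp add: algebra_simps)

lemma eqv_scale: "x \<approx> y \<Longrightarrow> scale r x \<approx> scale r y"
  unfolding eqv_def using I_scale[of "x - y" r] by (simp add: scale_right_diff_distrib)

lemma eqv_sum: "(\<And>i. i \<in> S \<Longrightarrow> f i \<approx> g i) \<Longrightarrow> sum f S \<approx> sum g S"
  by (induction S rule: infinite_finite_induct) (auto intro: eqv_add)

lemma eqv_mem: "x \<approx> y \<Longrightarrow> x \<in> I \<longleftrightarrow> y \<in> I"
  unfolding eqv_def using I_add[of "x - y" y] I_diff[of x "x - y"] by auto

lemma eqv_span: "x \<approx> y \<Longrightarrow> y \<in> span (T \<union> I) \<Longrightarrow> x \<in> span (T \<union> I)"
  unfolding eqv_def using span_add[OF span_base, of "x - y" "T \<union> I" y] by simp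

lemma prime:
  assumes "\<And>a. x * a * y \<in> I"
  shows "x \<in> I \<or> y \<in> I"
proof (rule ccontr)
  assume neg: "\<not> ?thesis"
  \<comment> \<open>\<open>P Q\<close> vanishes modulo \<open>I\<close>; as \<open>P\<close> is a noetherian right \<open>A/Q\<close>-module modulo \<open>I\<close>, it is
    finite-dimensional modulo \<open>I\<close> together with \<open>A/Q\<close>.\<close>
  define P where "P = {p. \<forall>a. p * a * y \<in> I}"
  define Q where "Q = {q. \<forall>p\<in>P. p * q \<in> I}"
  have P: "two_sided_ideal P"
    unfolding two_sided_ideal_def
  proof (intro conjI ballI allI)
    show "subspace P"
      by (auto simp: P_def subspace_def distrib_right scale_mult_left I_add I_scale)
    fix p b assume p: "p \<in> P"
    have "p * (b * a) * y \<in> I" for a using p unfolding P_def by blast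
    then show "p * b \<in> P" by (simp add: P_def mult.assoc)
    show "b * p \<in> P" using p by (simp add: P_def mult.assoc lI)
  qed
  have Q: "two_sided_ideal Q"
    unfolding two_sided_ideal_def
  proof (intro conjI ballI allI)
    show "subspace Q"
      by (auto simp: Q_def subspace_def distrib_left scale_mult_right I_add I_scale)
    fix q b assume q: "q \<in> Q"
    have "p * b * q \<in> I" if "p \<in> P" for p
      using q that P by (simp add: Q_def two_sided_ideal_def)
    then show "b * q \<in> Q" by (simp add: Q_def mult.assoc)
    show "q * b \<in> Q" using q by (simp add: Q_def rI flip: mult.assoc)
  qed
  have "I \<subseteq> P" "I \<subseteq> Q" by (auto simp: P_def Q_def lI rI)
  moreover have "x \<in> P" using assms by (simp add: P_def)
  moreover have "p * 1 * y \<in> I" if "p \<in> P" for p using that unfolding P_def by blast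
  then have "y \<in> Q" by (simp add: Q_def)
  ultimately have fP: "findim_mod P UNIV" and fQ: "findim_mod Q UNIV"
    using neg just P Q by blast+
  have subP: "subspace P" using P by (simp add: two_sided_ideal_def)
  \<comment> \<open>A maximal such right ideal is all of \<open>P\<close>, because adjoining the
    right ideal generated by any \<open>p\<close> in \<open>P\<close> keeps it finite-dimensional
    modulo \<open>I\<close>.\<close>
  let ?S = "{R. right_ideal_of R \<and> R \<subseteq> P \<and> findim_mod I R}"
  have "I \<in> ?S"
    using ideal \<open>I \<subseteq> P\<close> by (auto simp: right_ideal_of_def two_sided_ideal_def findim_mod_ideal)
  then have "\<exists>M\<in>?S. \<forall>R\<in>?S. M \<subseteq> R \<longrightarrow> R = M"
    by (rule right_maximal) blast
  then obtain M where M: "M \<in> ?S" and max: "\<forall>R\<in>?S. M \<subseteq> R \<longrightarrow> R = M" ..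
  have "p \<in> M" if p: "p \<in> P" for p
  proof -
    let ?R = "{m + p * a |m a. m \<in> M}"
    from fQ obtain F where F: "finite F" "span (F \<union> Q) = UNIV"
      by (auto simp: findim_mod_def)
    \<comment> \<open>Multiplication by \<open>p\<close> sends \<open>Q\<close> into
      \<open>I\<close>, so pA modulo \<open>I\<close> is an image of A/Q.\<close>
    have "p * a \<in> span ((*) p ` F \<union> I)" for a
    proof (rule lmult_span)
      show "a \<in> span (F \<union> Q)" using F by simp
      show "p * b \<in> span ((*) p ` F \<union> I)" if "b \<in> F \<union> Q" for b
        using that p by (auto simp: Q_def intro!: span_base)
    qed
    then have "findim_mod I (range ((*) p))"
      unfolding findim_mod_def using F by (intro exI[of _ "(*) p ` F"]) auto
    then have "findim_mod I (M \<union> range ((*) p))"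
      using M by (intro findim_mod_Un) auto
    then have "findim_mod I ?R"
      by (rule findim_mod_trans) (auto intro!: span_add intro: span_base)
    moreover have "subspace ?R"
    proof (rule subspaceI)
      have "0 \<in> M" using M by (auto simp: right_ideal_of_def subspace_0)
      then have "0 + p * 0 \<in> ?R" by blast
      then show "0 \<in> ?R" by simp
      show "u + v \<in> ?R" if "u \<in> ?R" "v \<in> ?R" for u v
      proof -
        from that obtain m a n b where "u = m + p * a" "v = n + p * b" "m \<in> M" "n \<in> M" by auto
        then have "u + v = (m + n) + p * (a + b)" "m + n \<in> M"
          using M by (auto simp: algebra_simps right_ideal_of_def subspace_add)
        then show ?thesis by blast
      qed
      show "scale r u \<in> ?R" if "u \<in> ?R" for r u
      proof -
        from that obtain m a where "u = m + p * a" "m \<in> M" by auto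
        then have "scale r u = scale r m + p * scale r a" "scale r m \<in> M"
          using M by (auto simp: scale_right_distrib scale_mult_right right_ideal_of_def subspace_scale)
        then show ?thesis by blast
      qed
    qed
    moreover have "u * b \<in> ?R" if "u \<in> ?R" for u b
    proof -
      from that obtain m a where "u = m + p * a" "m \<in> M" by auto
      then have "u * b = m * b + p * (a * b)" "m * b \<in> M"
        using M by (auto simp: distrib_right mult.assoc right_ideal_of_def)
      then show ?thesis by blast
    qed
    moreover have "?R \<subseteq> P"
      using M P p by (auto simp: two_sided_ideal_def intro!: subspace_add[OF subP])
    ultimately have "?R \<in> ?S" by (simp add: right_ideal_of_def)
    moreover have "M \<subseteq> ?R"
    proof
      fix m assume "m \<in> M"
      then have "m + p * 0 \<in> ?R" by blast
      then show "m \<in> ?R" by simp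
    qed
    ultimately have "?R = M" by (rule max[rule_format])
    moreover have "0 \<in> M" using M by (auto simp: right_ideal_of_def subspace_0)
    then have "0 + p * 1 \<in> ?R" by blast
    ultimately show ?thesis by simp
  qed
  then have "P \<subseteq> M" by blast
  with M have fM: "findim_mod I P" using findim_mod_subset by blast
  from fP obtain G where G: "finite G" "UNIV \<subseteq> span (G \<union> P)" by (auto simp: findim_mod_def)
  have "span (G \<union> P) \<subseteq> span (G \<union> P \<union> I)" by (rule span_mono) auto
  with G(2) have "UNIV \<subseteq> span (G \<union> P \<union> I)" by (rule subset_trans)
  with findim_mod_Un[OF findim_mod_finite[OF G(1)] fM] have "findim_mod I UNIV"
    by (rule findim_mod_trans)
  with infinite show False by simp
qed

text \<open>\<open>y\<close> is algebraic modulo \<open>I\<close>, so some nonzero polynomial in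
  \<open>y\<close> sends \<open>x\<close> into \<open>I\<close>. The hypothesis strips factors
  \<open>y\<close> until the constant coefficient is nonzero; then the relation is solved for
  \<open>x\<close>. As a polynomial in \<open>y\<close>, \<open>h\<close> commutes with
  \<open>y\<close>.\<close>

lemma cancel_inverse:
  assumes "x \<notin> I" and cancel: "\<And>b. b * (y * x) \<in> I \<Longrightarrow> b * x \<in> I"
  shows "\<exists>h. h * y = y * h \<and> h * (y * x) \<approx> x"
proof -
  have poly: "\<exists>h. h * y = y * h \<and> h * (y * x) \<approx> x"
    if "k n \<noteq> 0" "(\<Sum>i\<le>n. scale (k i) (y ^ i)) * x \<in> I" for n :: nat and k
    using that
  proof (induction n arbitrary: k)
    case 0
    then have "scale (k 0) x \<in> I" by (simp add: scale_mult_left)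
    from I_scale[OF this, of "inverse (k 0)"] 0 assms(1) show ?case by simp
  next
    case (Suc n)
    define g where "g = (\<Sum>i\<le>n. scale (k (Suc i)) (y ^ i))"
    have gy: "g * y = y * g"
      by (simp add: g_def sum_distrib_left sum_distrib_right scale_mult_left scale_mult_right
          power_commutes)
    have "(\<Sum>i\<le>Suc n. scale (k i) (y ^ i)) = scale (k 0) 1 + g * y"
      by (subst sum.atMost_Suc_shift)
        (simp add: g_def sum_distrib_right scale_mult_left power_commutes)
    then have *: "scale (k 0) x + g * (y * x) \<in> I"
      using Suc.prems(2) by (simp add: distrib_right scale_mult_left mult.assoc)
    show ?case
    proof (cases "k 0 = 0")
      case True
      with * cancel have "g * x \<in> I" by simp
      then show ?thesis using Suc.IH[of "\<lambda>i. k (Suc i)"] Suc.prems(1) by (simp add: g_def)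
    next
      case False
      let ?h = "scale (- inverse (k 0)) g"
      have "?h * (y * x) - x = scale (- inverse (k 0)) (g * (y * x) + scale (k 0) x)"
        using False by (simp add: scale_right_distrib scale_mult_left)
      also have "\<dots> \<in> I"
        using I_scale[OF *] by (simp only: add.commute)
      finally have "?h * (y * x) \<approx> x" by (simp add: eqv_def)
      moreover have "?h * y = y * ?h"
        by (simp add: scale_mult_left scale_mult_right gy)
      ultimately show ?thesis by blast
    qed
  qed
  have "commutator (y ^ i) (y ^ j) \<in> I" for i j
    by (simp add: commutator_def add.commute flip: power_add)
  then obtain n where "y ^ n \<in> span ((^) y ` {..<n} \<union> I)"
    using commuting_dependent[OF ideal, of "\<lambda>i. y ^ i"] by auto
  then obtain k where k: "y ^ n - (\<Sum>i<n. scale (k i) (y ^ i)) \<in> I"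
    using span_Un_coeffs[OF sub, of "{..<n}" "y ^ n" "\<lambda>i. y ^ i"] by auto
  \<comment> \<open>Turns the dependence of \<open>y ^ n\<close> on lower powers into a monic
    polynomial, whose leading coefficient is nonzero as \<open>poly\<close> demands.\<close>
  let ?k = "\<lambda>i. if i = n then 1 else - k i"
  have "(\<Sum>i\<le>n. scale (?k i) (y ^ i)) = y ^ n + (\<Sum>i<n. scale (?k i) (y ^ i))"
    by (simp add: lessThan_Suc_atMost[symmetric] add.commute)
  also have "(\<Sum>i<n. scale (?k i) (y ^ i)) = - (\<Sum>i<n. scale (k i) (y ^ i))"
    by (simp flip: sum_negf)
  finally have "(\<Sum>i\<le>n. scale (?k i) (y ^ i)) * x \<in> I"
    using k rI by simp
  then show ?thesis using poly[of ?k n] by simp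
qed

text \<open>Among elements outside \<open>I\<close>, let \<open>x\<close> have maximal left
  annihilator modulo \<open>I\<close>; every \<open>x * b\<close> outside \<open>I\<close> then has
  the same one. Primeness gives \<open>x * a * x\<close> outside \<open>I\<close>, and cancelling
  \<open>y = x * a\<close> makes \<open>e = y * h\<close> a left identity on \<open>x\<close>, hence
  on \<open>y\<close> and on itself. The last conjunct transfers the annihilator property to
  \<open>e\<close> and will make eAe a division algebra.\<close>

lemma idempotent_exists:
  "\<exists>e. e \<notin> I \<and> e * e \<approx> e \<and> (\<forall>a b. e * b \<notin> I \<longrightarrow> a * (e * b) \<in> I \<longrightarrow> a * e \<in> I)"
proof -
  define L where "L x = {a. a * x \<in> I}" for x
  have L: "left_ideal_of (L x)" for x
    unfolding left_ideal_of_def subspace_def L_def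
    by (auto simp: distrib_right scale_mult_left I_add I_scale lI mult.assoc)
  have "1 \<notin> I"
  proof
    assume "1 \<in> I"
    then have "UNIV \<subseteq> I" using lI[of 1] by auto
    with infinite findim_mod_ideal show False using findim_mod_subset by blast
  qed
  then have "L 1 \<in> {L x |x. x \<notin> I}" by blast
  then have "\<exists>M\<in>{L x |x. x \<notin> I}. \<forall>J\<in>{L x |x. x \<notin> I}. M \<subseteq> J \<longrightarrow> J = M"
    by (rule left_maximal) (use L in blast)
  then obtain x where x: "x \<notin> I" and max: "\<And>z. z \<notin> I \<Longrightarrow> L x \<subseteq> L z \<Longrightarrow> L z = L x"
    by blast
  have A: "a * x \<in> I" if "x * b \<notin> I" "a * (x * b) \<in> I" for a b
  proof -
    have "L x \<subseteq> L (x * b)" by (auto simp: L_def rI simp flip: mult.assoc)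
    with max that(1) have "L (x * b) = L x" by blast
    with that(2) show ?thesis by (auto simp: L_def)
  qed
  obtain a where a: "x * a * x \<notin> I" using prime[of x x] x by blast
  define y where "y = x * a"
  have "b * x \<in> I" if "b * (y * x) \<in> I" for b
    using A[of "a * x" b] that a by (simp add: y_def mult.assoc)
  then obtain h where h: "h * y = y * h" "h * (y * x) \<approx> x"
    using cancel_inverse[OF x] by blast
  define e where "e = y * h"
  have ex: "e * x \<approx> x" using h by (simp add: e_def mult.assoc flip: h(1))
  have "e * y \<approx> y" using eqv_rmult[OF ex, of a] by (simp add: y_def mult.assoc)
  from eqv_rmult[OF this, of h] have "e * e \<approx> e" by (simp add: e_def mult.assoc)
  moreover have "e \<notin> I"
    using eqv_mem[OF ex] x rI by blast
  moreover have "c * e \<in> I" if "e * b \<notin> I" "c * (e * b) \<in> I" for b c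
  proof -
    have "c * x \<in> I"
      using A[of "a * h * b" c] that by (simp add: e_def y_def mult.assoc)
    from rI[OF this, of "a * h"] show ?thesis by (simp add: e_def y_def mult.assoc)
  qed
  ultimately show ?thesis by blast
qed

end

section \<open>The division algebra eAe modulo \<open>I\<close>\<close>

locale corner_division = just_infinite scale I for scale :: "'k::field \<Rightarrow> 'a::ring_1 \<Rightarrow> 'a" and I +
  fixes e :: 'a
  assumes e_notin: "e \<notin> I" and e_idem: "e * e \<approx> e"
    and e_cancel: "e * b \<notin> I \<Longrightarrow> a * (e * b) \<in> I \<Longrightarrow> a * e \<in> I"
begin

text \<open>The full preimage in A of the corner of A/I at the class of \<open>e\<close>; it
  contains \<open>I\<close>.\<close>

definition corner :: "'a set"
  where "corner = {z. e * z \<approx> z \<and> z * e \<approx> z}"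

lemma cornerD: "z \<in> corner \<Longrightarrow> e * z \<approx> z" "z \<in> corner \<Longrightarrow> z * e \<approx> z"
  by (simp_all add: corner_def)

lemma corner_e: "e \<in> corner"
  by (simp add: corner_def e_idem)

lemma corner_zero: "0 \<in> corner"
  by (simp add: corner_def)

lemma corner_add: "z \<in> corner \<Longrightarrow> w \<in> corner \<Longrightarrow> z + w \<in> corner"
  by (auto simp: corner_def distrib_left distrib_right intro: eqv_add)

lemma corner_diff: "z \<in> corner \<Longrightarrow> w \<in> corner \<Longrightarrow> z - w \<in> corner"
  by (auto simp: corner_def left_diff_distrib right_diff_distrib intro: eqv_diff)

lemma corner_scale: "z \<in> corner \<Longrightarrow> scale r z \<in> corner"
  by (auto simp: corner_def scale_mult_left scale_mult_right intro: eqv_scale)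

lemma corner_sum: "(\<And>i. i \<in> S \<Longrightarrow> f i \<in> corner) \<Longrightarrow> sum f S \<in> corner"
  by (induction S rule: infinite_finite_induct) (auto intro: corner_add corner_zero)

lemma corner_mult: "z \<in> corner \<Longrightarrow> w \<in> corner \<Longrightarrow> z * w \<in> corner"
  using eqv_rmult[of "e * z" z w] eqv_lmult[of "w * e" w z] by (simp add: corner_def mult.assoc)

lemma corner_compress: "e * a * e \<in> corner"
  using eqv_rmult[OF e_idem, of "a * e"] eqv_lmult[OF e_idem, of "e * a"]
  by (simp add: corner_def mult.assoc)

lemma corner_cancel:
  assumes "z \<in> corner" "z \<notin> I" "a * z \<in> I"
  shows "a * e \<in> I"
  using e_cancel[of z a] eqv_mem[OF cornerD(1)] eqv_mem[OF eqv_lmult[OF cornerD(1)]] assms by blast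

text \<open>\<open>cancel_inverse\<close> is applied to \<open>e\<close> in the role of
  \<open>x\<close>; compressing the resulting \<open>h\<close> to \<open>e * h * e\<close> puts the
  inverse inside the corner.\<close>

lemma corner_inverse:
  assumes z: "z \<in> corner" "z \<notin> I"
  shows "\<exists>d\<in>corner. d * z \<approx> e"
proof -
  have ze: "z * e \<approx> z" and ez: "e * z \<approx> z" using z(1) by (rule cornerD)+
  have "b * e \<in> I" if "b * (z * e) \<in> I" for b
    using that eqv_mem[OF eqv_lmult[OF ze]] corner_cancel[OF z] by blast
  then obtain h where h: "h * (z * e) \<approx> e"
    using cancel_inverse[OF e_notin] by blast
  have "(e * h * e) * z \<approx> e * h * z" using eqv_lmult[OF ez, of "e * h"] by (simp add: mult.assoc)
  also have "e * h * z \<approx> e * h * (z * e)" by (rule eqv_sym[OF eqv_lmult[OF ze]])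
  also have "e * h * (z * e) \<approx> e * e" using eqv_lmult[OF h, of e] by (simp add: mult.assoc)
  also have "e * e \<approx> e" by (rule e_idem)
  finally show ?thesis using corner_compress by blast
qed

text \<open>If every finite commuting set could be enlarged, iterating the choice \<open>Z\<close>
  would give a commuting sequence independent modulo \<open>I\<close>, against
  \<open>commuting_dependent\<close>.\<close>

lemma maximal_commuting_exists:
  "\<exists>F. finite F \<and> F \<subseteq> corner \<and>
    (\<forall>z\<in>corner. (\<forall>c\<in>F. commutator z c \<in> I) \<longrightarrow> z \<in> span (F \<union> I)) \<and> (\<forall>c\<in>F. \<forall>d\<in>F. commutator c d \<in> I)"
proof (rule ccontr)
  define good where "good F \<longleftrightarrow> finite F \<and> F \<subseteq> corner \<and> (\<forall>c\<in>F. \<forall>d\<in>F. commutator c d \<in> I)" for F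
  assume "\<not> ?thesis"
  then have "\<forall>F. \<exists>z. good F \<longrightarrow> z \<in> corner \<and> (\<forall>c\<in>F. commutator z c \<in> I) \<and> z \<notin> span (F \<union> I)"
    unfolding good_def by blast
  then obtain Z where Z: "\<And>F. good F \<Longrightarrow>
      Z F \<in> corner \<and> (\<forall>c\<in>F. commutator (Z F) c \<in> I) \<and> Z F \<notin> span (F \<union> I)"
    by metis
  define F where "F = rec_nat {} (\<lambda>_ F. insert (Z F) F)"
  have F: "F 0 = {}" "\<And>n. F (Suc n) = insert (Z (F n)) (F n)" by (simp_all add: F_def)
  define c where "c n = Z (F n)" for n
  have Fc: "F n = c ` {..<n}" for n
    by (induction n) (simp_all add: F c_def lessThan_Suc)
  have flip: "commutator b a = - commutator a b" for a b :: 'a by (simp add: commutator_def)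
  have good: "good (F n)" for n
  proof (induction n)
    case 0
    then show ?case by (simp add: F good_def)
  next
    case (Suc n)
    have "commutator b (Z (F n)) \<in> I" if "b \<in> F n" for b
      using Z[OF Suc] that I_neg flip[of b "Z (F n)"] by auto
    moreover have "commutator (Z (F n)) (Z (F n)) = 0" by (simp add: commutator_def)
    ultimately show ?case using Z[OF Suc] Suc by (auto simp: F good_def)
  qed
  have "commutator (c i) (c j) \<in> I" for i j
  proof -
    have "c i \<in> F (Suc (max i j))" "c j \<in> F (Suc (max i j))" unfolding Fc by auto
    with good[of "Suc (max i j)"] show ?thesis by (auto simp: good_def)
  qed
  then obtain n where "c n \<in> span (c ` {..<n} \<union> I)" using commuting_dependent[OF ideal] by blast
  with Z[OF good[of n]] show False by (simp add: Fc[symmetric]) (simp add: c_def)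
qed

text \<open>The operator of the tensor with component \<open>w c\<close> at \<open>c\<close>:
  coefficients multiply \<open>v\<close> on the left, elements of \<open>F\<close> on the
  right.\<close>

definition app :: "'a set \<Rightarrow> ('a \<Rightarrow> 'a) \<Rightarrow> 'a \<Rightarrow> 'a"
  where "app F w v = (\<Sum>c\<in>F. w c * v * c)"

lemma app_diff: "app F w (v - v') = app F w v - app F w v'"
  by (simp add: app_def left_diff_distrib right_diff_distrib sum_subtractf)

lemma app_diff_lmult: "app F (\<lambda>c. w c - d * w' c) v = app F w v - d * app F w' v"
  by (simp add: app_def left_diff_distrib sum_subtractf sum_distrib_left mult.assoc)

lemma app_lmult: "app F (\<lambda>c. d * w c) v = d * app F w v"
  by (simp add: app_def sum_distrib_left mult.assoc)

end

section \<open>Finite dimension of eAe by density over a maximal commuting set\<close>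

locale corner_commuting = corner_division scale I e for scale :: "'k::field \<Rightarrow> 'a::ring_1 \<Rightarrow> 'a" and I e +
  fixes F :: "'a set"
  assumes finite_F: "finite F" and F_corner: "F \<subseteq> corner"
    and F_max: "z \<in> corner \<Longrightarrow> (\<And>c. c \<in> F \<Longrightarrow> commutator z c \<in> I) \<Longrightarrow> z \<in> span (F \<union> I)"
    and F_comm: "c \<in> F \<Longrightarrow> d \<in> F \<Longrightarrow> commutator c d \<in> I"
begin

definition coeffs :: "('a \<Rightarrow> 'a) set"
  where "coeffs = {w. \<forall>c\<in>F. w c \<in> corner}"

lemma app_corner: "w \<in> coeffs \<Longrightarrow> v \<in> corner \<Longrightarrow> app F w v \<in> corner"
  unfolding app_def coeffs_def using F_corner by (intro corner_sum corner_mult) auto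

lemma app_in_I: "(\<And>c. c \<in> F \<Longrightarrow> w c \<in> I) \<Longrightarrow> app F w v \<in> I"
  unfolding app_def by (intro I_sum rI)

text \<open>\<open>G\<close> bounds the support of the operators that \<open>V\<close> has to
  detect. The induction that follows enlarges it by one element at a time; at \<open>G = F\<close>
  the support condition is vacuous.\<close>

definition tests :: "'a set \<Rightarrow> 'a set \<Rightarrow> bool"
  where "tests G V \<longleftrightarrow> (\<forall>w\<in>coeffs. (\<forall>c\<in>F - G. w c \<in> I) \<longrightarrow> (\<forall>v\<in>V. app F w v \<in> I)
    \<longrightarrow> (\<forall>v\<in>corner. app F w v \<in> I))"

lemma testsD:
  assumes "tests G V" "w \<in> coeffs" "\<And>c. c \<in> F - G \<Longrightarrow> w c \<in> I" "\<And>v. v \<in> V \<Longrightarrow> app F w v \<in> I"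
    "v \<in> corner"
  shows "app F w v \<in> I"
  using assms by (simp add: tests_def)

text \<open>
  This replaces a dimension count in the left vector space of coefficient tuples over the division
  algebra: each new test vector eliminates one coefficient.
\<close>

lemma finite_test_set:
  assumes "G \<subseteq> F"
  shows "\<exists>V. finite V \<and> V \<subseteq> corner \<and> tests G V"
proof -
  have "finite G" using assms finite_F finite_subset by blast
  then show ?thesis using assms
  proof (induction G)
    case empty
    have "tests {} {}" by (auto simp: tests_def intro: app_in_I)
    then show ?case by blast
  next
    case (insert g G)
    then obtain V where V: "finite V" "V \<subseteq> corner" "tests G V" by blast
    note IH = testsD[OF V(3)]
    show ?case
    proof (cases "tests (insert g G) V")
      case True
      then show ?thesis using V by blast
    next
      case False
      then obtain w0 v0 where w0: "w0 \<in> coeffs" "\<And>c. c \<in> F - insert g G \<Longrightarrow> w0 c \<in> I"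
          "\<And>v. v \<in> V \<Longrightarrow> app F w0 v \<in> I" and v0: "v0 \<in> corner" "app F w0 v0 \<notin> I"
        unfolding tests_def by blast
      have "w0 g \<notin> I"
      proof
        assume "w0 g \<in> I"
        then have "w0 c \<in> I" if "c \<in> F - G" for c using that w0(2) by (cases "c = g") auto
        with IH[OF w0(1) _ w0(3) v0(1)] v0(2) show False by blast
      qed
      moreover have "w0 g \<in> corner" using w0(1) insert.prems by (auto simp: coeffs_def)
      ultimately obtain u where u: "u \<in> corner" "u * w0 g \<approx> e" using corner_inverse by blast
      have null: "app F w v \<in> I" if w: "w \<in> coeffs" "\<And>c. c \<in> F - insert g G \<Longrightarrow> w c \<in> I"
        "\<And>v. v \<in> insert v0 V \<Longrightarrow> app F w v \<in> I" and v: "v \<in> corner" for w v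
      proof -
        \<comment> \<open>Chosen so that \<open>w - d * w0\<close> has its coefficient at
          \<open>g\<close> in \<open>I\<close> and falls under the hypothesis for
          \<open>G\<close>.\<close>
        define d where "d = w g * u"
        have wg: "w g \<in> corner" using w(1) insert.prems by (auto simp: coeffs_def)
        have d: "d \<in> corner" unfolding d_def by (intro corner_mult wg u)
        let ?w = "\<lambda>c. w c - d * w0 c"
        have "d * w0 g \<approx> w g"
          using eqv_trans[OF eqv_lmult[OF u(2), of "w g"] cornerD(2)[OF wg]] by (simp add: d_def mult.assoc)
        then have "?w g \<in> I" using eqv_sym[of "d * w0 g" "w g"] by (simp add: eqv_def)
        then have "?w c \<in> I" if "c \<in> F - G" for c
          using that w(2) w0(2) by (cases "c = g") (auto intro!: I_diff lI)
        moreover have "?w \<in> coeffs"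
          using w(1) w0(1) d by (auto simp: coeffs_def intro!: corner_diff corner_mult)
        moreover have "app F ?w v' \<in> I" if "v' \<in> V" for v'
          using that w(3) w0(3) by (auto simp: app_diff_lmult intro!: I_diff lI)
        ultimately have null: "app F w v' - d * app F w0 v' \<in> I" if "v' \<in> corner" for v'
          using IH[of ?w v'] that by (simp add: app_diff_lmult)
        \<comment> \<open>\<open>w\<close> kills the test vector \<open>v0\<close>, and
          \<open>w - d * w0\<close> kills the whole corner. As \<open>app F w0 v0\<close> can be
          cancelled, \<open>d\<close> is forced into \<open>I\<close>.\<close>
        have "d * app F w0 v0 \<in> I"
          using I_diff[OF w(3)[of v0] null[OF v0(1)]] by simp
        then have "d * e \<in> I"
          using corner_cancel[OF app_corner[OF w0(1) v0(1)] v0(2)] by blast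
        then have "d \<in> I" using eqv_mem[OF cornerD(2)[OF d]] by simp
        then have "d * app F w0 v \<in> I" by (rule rI)
        from I_add[OF null[OF v] this] show ?thesis by simp
      qed
      have "tests (insert g G) (insert v0 V)"
        unfolding tests_def
      proof (intro ballI impI)
        fix w v assume "w \<in> coeffs" "\<forall>c\<in>F - insert g G. w c \<in> I"
          "\<forall>v\<in>insert v0 V. app F w v \<in> I" "v \<in> corner"
        then show "app F w v \<in> I" by - (rule null, auto)
      qed
      then show ?thesis using V v0 by blast
    qed
  qed
qed

text \<open>A product of two members of \<open>F\<close> commutes with \<open>F\<close>, so by
  maximality it lies in the span of \<open>F\<close> modulo \<open>I\<close>. Its structure
  constants \<open>k\<close> absorb right multiplication by \<open>c\<close> into the
  coefficients.\<close>

lemma app_rmult: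
  assumes w: "w \<in> coeffs" and c: "c \<in> F"
  shows "\<exists>w'\<in>coeffs. \<forall>v. app F w' v \<approx> app F w v * c"
proof -
  have "b * c \<in> span (F \<union> I)" if b: "b \<in> F" for b
  proof (rule F_max)
    show "b * c \<in> corner" using b c F_corner by (intro corner_mult) auto
    fix d assume d: "d \<in> F"
    have "commutator (b * c) d = b * commutator c d + commutator b d * c"
      by (simp add: commutator_def algebra_simps)
    then show "commutator (b * c) d \<in> I"
      using F_comm[OF c d] F_comm[OF b d] by (auto intro: I_add lI rI)
  qed
  then have "\<forall>b. \<exists>k. b \<in> F \<longrightarrow> b * c \<approx> (\<Sum>a\<in>F. scale (k a) a)"
    using span_Un_coeffs[OF sub finite_F, where c = "\<lambda>x. x"] unfolding eqv_def by fastforce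
  then obtain k where k: "\<And>b. b \<in> F \<Longrightarrow> b * c \<approx> (\<Sum>a\<in>F. scale (k b a) a)" by metis
  define w' where "w' a = (\<Sum>b\<in>F. scale (k b a) (w b))" for a
  have "w' \<in> coeffs" using w unfolding coeffs_def w'_def by (auto intro!: corner_sum corner_scale)
  moreover have "app F w' v \<approx> app F w v * c" for v
  proof -
    have "app F w' v = (\<Sum>a\<in>F. \<Sum>b\<in>F. scale (k b a) (w b * v * a))"
      by (simp add: app_def w'_def sum_distrib_right scale_mult_left)
    also have "\<dots> = (\<Sum>b\<in>F. \<Sum>a\<in>F. scale (k b a) (w b * v * a))"
      by (rule sum.swap)
    also have "\<dots> = (\<Sum>b\<in>F. w b * v * (\<Sum>a\<in>F. scale (k b a) a))"
      by (simp add: sum_distrib_left scale_mult_right)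
    also have "\<dots> \<approx> (\<Sum>b\<in>F. w b * v * (b * c))"
      by (intro eqv_sum eqv_lmult eqv_sym[OF k])
    also have "(\<Sum>b\<in>F. w b * v * (b * c)) = app F w v * c"
      by (simp add: app_def sum_distrib_right mult.assoc)
    finally show ?thesis .
  qed
  ultimately show ?thesis by blast
qed

text \<open>
  Jacobson density for the division algebra \<open>D\<close> as a \<open>D\<close>-\<open>K\<close>-bimodule, where \<open>K\<close> is the span of \<open>F\<close>:
  its endomorphisms are right multiplications by the centralizer of \<open>K\<close>, which is \<open>K\<close>.
\<close>

lemma density:
  assumes "finite V" "V \<subseteq> corner" "v \<in> corner"
    and "\<And>w. w \<in> coeffs \<Longrightarrow> (\<And>u. u \<in> V \<Longrightarrow> app F w u \<in> I) \<Longrightarrow> app F w v \<in> I"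
  shows "v \<in> span ((\<lambda>(u, c). u * c) ` (V \<times> F) \<union> I)"
  using assms
proof (induction V arbitrary: v)
  case empty
  \<comment> \<open>This makes the map from \<open>v\<close> to \<open>e * v * e\<close> an
    admissible operator. With \<open>V\<close> empty the hypothesis forces it to annihilate
    \<open>v\<close>, yet on the corner it is the identity modulo \<open>I\<close>.\<close>
  have "e \<in> span (F \<union> I)"
  proof (rule F_max[OF corner_e])
    fix c assume "c \<in> F"
    with F_corner have "e * c \<approx> c" "c * e \<approx> c" by (auto intro: cornerD)
    then have "e * c \<approx> c * e" using eqv_trans eqv_sym by blast
    then show "commutator e c \<in> I" by (simp add: eqv_def commutator_def)
  qed
  then obtain k where k: "e \<approx> (\<Sum>c\<in>F. scale (k c) c)"
    using span_Un_coeffs[OF sub finite_F, where c = "\<lambda>x. x"] unfolding eqv_def by fastforce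
  have "(\<lambda>c. scale (k c) e) \<in> coeffs" by (simp add: coeffs_def corner_scale corner_e)
  with empty.prems have "app F (\<lambda>c. scale (k c) e) v \<in> I" by blast
  moreover have "app F (\<lambda>c. scale (k c) e) v = e * v * (\<Sum>c\<in>F. scale (k c) c)"
    by (simp add: app_def sum_distrib_left scale_mult_left scale_mult_right)
  moreover have "e * v * (\<Sum>c\<in>F. scale (k c) c) \<approx> e * v * e"
    by (rule eqv_lmult[OF eqv_sym[OF k]])
  moreover have "e * v * e \<approx> v * e" "v * e \<approx> v"
    using cornerD[OF empty.prems(2)] by (auto intro: eqv_rmult)
  ultimately have "v \<in> I" using eqv_mem by metis
  then show ?case by (simp add: span_base)
next
  case (insert u V)
  have uV: "V \<subseteq> corner" "u \<in> corner" using insert.prems by auto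
  have mono: "span ((\<lambda>(u, c). u * c) ` (V \<times> F) \<union> I) \<subseteq> span ((\<lambda>(u, c). u * c) ` (insert u V \<times> F) \<union> I)"
    by (rule span_mono) auto
  show ?case
  proof (cases "\<forall>w\<in>coeffs. (\<forall>u\<in>V. app F w u \<in> I) \<longrightarrow> app F w u \<in> I")
    case True
    then have "v \<in> span ((\<lambda>(u, c). u * c) ` (V \<times> F) \<union> I)"
      using uV insert.prems by (intro insert.IH) auto
    with mono show ?thesis by blast
  next
    case False
    then obtain w0 where w0: "w0 \<in> coeffs" "\<And>u. u \<in> V \<Longrightarrow> app F w0 u \<in> I" "app F w0 u \<notin> I" by blast
    then obtain d where d: "d \<in> corner" "d * app F w0 u \<approx> e"
      using corner_inverse[OF app_corner[OF w0(1) uV(2)]] by blast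
    \<comment> \<open>Normalised to kill \<open>V\<close> and to send \<open>u\<close> to
      \<open>e\<close>; its value \<open>z\<close> at \<open>v\<close> is the factor for which
      \<open>v\<close> should equal \<open>u * z\<close> up to products from \<open>V\<close> and
      \<open>F\<close>.\<close>
    define w1 where "w1 c = d * w0 c" for c
    have w1: "w1 \<in> coeffs" using w0(1) d(1) by (auto simp: coeffs_def w1_def intro: corner_mult)
    have w1_app: "app F w1 x = d * app F w0 x" for x by (simp add: w1_def[abs_def] app_lmult)
    have w1_u: "app F w1 u \<approx> e" and w1_V: "\<And>x. x \<in> V \<Longrightarrow> app F w1 x \<in> I"
      using d(2) w0(2) by (auto simp: w1_app intro: lI)
    define z where "z = app F w1 v"
    have z: "z \<in> corner" unfolding z_def by (intro app_corner w1 insert.prems)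
    have key: "app F w v \<approx> app F w u * z" if w: "w \<in> coeffs" "\<And>x. x \<in> V \<Longrightarrow> app F w x \<in> I" for w
    proof -
      let ?d = "app F w u"
      let ?w = "\<lambda>c. w c - ?d * w1 c"
      have dc: "?d \<in> corner" by (intro app_corner w uV)
      have "?w \<in> coeffs"
        using w(1) w1 dc by (auto simp: coeffs_def intro!: corner_diff corner_mult)
      moreover have "app F ?w x \<in> I" if "x \<in> insert u V" for x
      proof (cases "x = u")
        case True
        have "?d * app F w1 u \<approx> ?d"
          using eqv_trans[OF eqv_lmult[OF w1_u] cornerD(2)[OF dc]] .
        from eqv_sym[OF this] show ?thesis using True by (simp add: app_diff_lmult eqv_def)
      next
        case False
        then show ?thesis using that w(2) w1_V by (auto simp: app_diff_lmult intro!: I_diff lI)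
      qed
      ultimately have "app F ?w v \<in> I" using insert.prems(3) by blast
      then show ?thesis by (simp add: app_diff_lmult eqv_def z_def)
    qed
    \<comment> \<open>\<open>key\<close> is applied to \<open>w1\<close> followed by right
      multiplication by \<open>c\<close>, which sends \<open>u\<close> to \<open>c\<close> and
      \<open>v\<close> to \<open>z * c\<close>.\<close>
    have zc: "z * c \<approx> c * z" if c: "c \<in> F" for c
    proof -
      obtain w where w: "w \<in> coeffs" "\<And>x. app F w x \<approx> app F w1 x * c"
        using app_rmult[OF w1 c] by blast
      have "app F w x \<in> I" if "x \<in> V" for x
        using eqv_mem[OF w(2)] w1_V[OF that] rI by blast
      from key[OF w(1) this] have 1: "app F w v \<approx> app F w u * z" .
      have "c \<in> corner" using c F_corner by blast
      then have "app F w1 u * c \<approx> c"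
        using eqv_trans[OF eqv_rmult[OF w1_u] cornerD(1)] by blast
      with w(2) have "app F w u \<approx> c" using eqv_trans by blast
      with 1 have 2: "app F w v \<approx> c * z" using eqv_trans eqv_rmult by blast
      have "app F w v \<approx> z * c" using w(2)[of v] by (simp add: z_def)
      with 2 show ?thesis using eqv_trans eqv_sym by blast
    qed
    have "z \<in> span (F \<union> I)"
      using zc by (intro F_max z) (simp add: eqv_def commutator_def)
    then have uz: "u * z \<in> span ((\<lambda>(u, c). u * c) ` (insert u V \<times> F) \<union> I)"
      by (rule lmult_span) (auto intro!: span_base lI)
    \<comment> \<open>By \<open>key\<close>, and with \<open>z\<close> moved past \<open>F\<close>,
      operators that kill \<open>V\<close> take the same value at \<open>v\<close> and at
      \<open>u * z\<close>.\<close>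
    have "v - u * z \<in> span ((\<lambda>(u, c). u * c) ` (V \<times> F) \<union> I)"
    proof (rule insert.IH)
      show "V \<subseteq> corner" by (rule uV)
      show "v - u * z \<in> corner" by (intro corner_diff corner_mult uV z insert.prems)
      fix w assume w: "w \<in> coeffs" "\<And>x. x \<in> V \<Longrightarrow> app F w x \<in> I"
      have "app F w (u * z) = (\<Sum>c\<in>F. w c * u * (z * c))" by (simp add: app_def mult.assoc)
      also have "\<dots> \<approx> (\<Sum>c\<in>F. w c * u * (c * z))" by (intro eqv_sum eqv_lmult zc)
      also have "(\<Sum>c\<in>F. w c * u * (c * z)) = app F w u * z"
        by (simp add: app_def sum_distrib_right mult.assoc)
      also have "app F w u * z \<approx> app F w v" by (rule eqv_sym[OF key[OF w]])
      finally show "app F w (v - u * z) \<in> I"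
        using eqv_sym[of "app F w (u * z)" "app F w v"] by (simp add: app_diff eqv_def)
    qed
    with mono uz have "(v - u * z) + u * z \<in> span ((\<lambda>(u, c). u * c) ` (insert u V \<times> F) \<union> I)"
      by (intro span_add) auto
    then show ?thesis by simp
  qed
qed

text \<open>When \<open>V\<close> detects all operators, the hypothesis of \<open>density\<close>
  holds for every \<open>v\<close> in the corner, which is therefore spanned modulo \<open>I\<close>
  by finitely many products.\<close>

lemma findim_corner: "findim_mod I corner"
proof -
  obtain V where V: "finite V" "V \<subseteq> corner" and null: "tests F V"
    using finite_test_set[of F] by blast
  have "corner \<subseteq> span ((\<lambda>(u, c). u * c) ` (V \<times> F) \<union> I)"
  proof
    fix v assume v: "v \<in> corner"
    show "v \<in> span ((\<lambda>(u, c). u * c) ` (V \<times> F) \<union> I)"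
    proof (rule density[OF V v])
      fix w assume "w \<in> coeffs" "\<And>u. u \<in> V \<Longrightarrow> app F w u \<in> I"
      then show "app F w v \<in> I" using testsD[OF null _ _ _ v] by simp
    qed
  qed
  moreover have "finite ((\<lambda>(u, c). u * c) ` (V \<times> F))" using V finite_F by simp
  ultimately show ?thesis unfolding findim_mod_def by blast
qed

end

section \<open>From eAe to eA, and from eA to A/I\<close>

context corner_division
begin

lemma findim_corner: "findim_mod I corner"
proof -
  obtain F where "finite F" "F \<subseteq> corner"
    "\<forall>z\<in>corner. (\<forall>c\<in>F. commutator z c \<in> I) \<longrightarrow> z \<in> span (F \<union> I)" "\<forall>c\<in>F. \<forall>d\<in>F. commutator c d \<in> I"
    using maximal_commuting_exists by blast
  then interpret corner_commuting scale I e F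
    by unfold_locales auto
  show ?thesis by (rule findim_corner)
qed

text \<open>Let \<open>M\<close> be maximal among left ideals with eM finite-dimensional modulo
  \<open>I\<close>. Adjoining the left ideal of \<open>e * b\<close> adds only (eAe)b to eM, so
  \<open>M\<close> contains every \<open>e * b\<close>, and eA = e(eA) modulo \<open>I\<close> lies
  in eM.\<close>

lemma findim_right_ideal: "findim_mod I (range ((*) e))"
proof -
  let ?S = "{Q. left_ideal_of Q \<and> findim_mod I ((*) e ` Q)}"
  have "{0} \<in> ?S"
    by (auto simp: left_ideal_of_def subspace_def intro: findim_mod_finite)
  then have "\<exists>M\<in>?S. \<forall>Q\<in>?S. M \<subseteq> Q \<longrightarrow> Q = M"
    by (rule left_maximal) blast
  then obtain M where M: "M \<in> ?S" and max: "\<forall>Q\<in>?S. M \<subseteq> Q \<longrightarrow> Q = M" ..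
  from findim_corner obtain G where G: "finite G" "corner \<subseteq> span (G \<union> I)" by (auto simp: findim_mod_def)
  have inM: "e * b \<in> M" for b
  proof -
    let ?Q = "{m + a * (e * b) |m a. m \<in> M}"
    have "subspace ?Q"
    proof (rule subspaceI)
      have "0 \<in> M" using M by (auto simp: left_ideal_of_def subspace_0)
      then have "0 + 0 * (e * b) \<in> ?Q" by blast
      then show "0 \<in> ?Q" by simp
      show "u + v \<in> ?Q" if "u \<in> ?Q" "v \<in> ?Q" for u v
      proof -
        from that obtain m a n c where "u = m + a * (e * b)" "v = n + c * (e * b)" "m \<in> M" "n \<in> M" by auto
        then have "u + v = (m + n) + (a + c) * (e * b)" "m + n \<in> M"
          using M by (auto simp: algebra_simps left_ideal_of_def subspace_add)
        then show ?thesis by blast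
      qed
      show "scale r u \<in> ?Q" if "u \<in> ?Q" for r u
      proof -
        from that obtain m a where "u = m + a * (e * b)" "m \<in> M" by auto
        then have "scale r u = scale r m + scale r a * (e * b)" "scale r m \<in> M"
          using M by (auto simp: scale_right_distrib scale_mult_left left_ideal_of_def subspace_scale)
        then show ?thesis by blast
      qed
    qed
    moreover have "c * u \<in> ?Q" if "u \<in> ?Q" for u c
    proof -
      from that obtain m a where "u = m + a * (e * b)" "m \<in> M" by auto
      then have "c * u = c * m + (c * a) * (e * b)" "c * m \<in> M"
        using M by (auto simp: distrib_left mult.assoc left_ideal_of_def)
      then show ?thesis by blast
    qed
    moreover have "findim_mod I ((*) e ` ?Q)"
    proof (rule findim_mod_trans)
      show "findim_mod I ((*) e ` M \<union> (\<lambda>g. g * b) ` G)"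
        by (rule findim_mod_Un) (use M G in \<open>auto intro: findim_mod_finite\<close>)
      have "e * (m + a * (e * b)) \<in> span ((*) e ` M \<union> (\<lambda>g. g * b) ` G \<union> I)" if "m \<in> M" for m a
      proof -
        have "e * a * e \<in> span (G \<union> I)" using G corner_compress by blast
        then have "e * a * e * b \<in> span ((*) e ` M \<union> (\<lambda>g. g * b) ` G \<union> I)"
          by (rule rmult_span) (auto intro!: span_base rI)
        moreover have "e * m \<in> span ((*) e ` M \<union> (\<lambda>g. g * b) ` G \<union> I)"
          using that by (intro span_base) auto
        ultimately show ?thesis
          by (simp add: distrib_left span_add flip: mult.assoc)
      qed
      then show "(*) e ` ?Q \<subseteq> span ((*) e ` M \<union> (\<lambda>g. g * b) ` G \<union> I)" by auto
    qed
    ultimately have "?Q \<in> ?S" by (simp add: left_ideal_of_def)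
    moreover have "M \<subseteq> ?Q"
    proof
      fix m assume "m \<in> M"
      then have "m + 0 * (e * b) \<in> ?Q" by blast
      then show "m \<in> ?Q" by simp
    qed
    ultimately have "?Q = M" by (rule max[rule_format])
    moreover have "0 \<in> M" using M by (auto simp: left_ideal_of_def subspace_0)
    then have "0 + 1 * (e * b) \<in> ?Q" by blast
    ultimately show ?thesis by simp
  qed
  have "e * b \<in> span ((*) e ` M \<union> I)" for b
  proof (rule eqv_span)
    show "e * b \<approx> e * (e * b)"
      using eqv_sym[OF eqv_rmult[OF e_idem, of b]] by (simp add: mult.assoc)
    show "e * (e * b) \<in> span ((*) e ` M \<union> I)"
      using inM by (intro span_base) auto
  qed
  then show ?thesis using M findim_mod_trans[of I "(*) e ` M" "range ((*) e)"] by blast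
qed

lemma contradiction: False
proof -
  from findim_right_ideal obtain G where G: "finite G" "range ((*) e) \<subseteq> span (G \<union> I)"
    by (auto simp: findim_mod_def)
  \<comment> \<open>The annihilator of the vectors \<open>e * g\<close>. Each \<open>g\<close> costs
    finite codimension by \<open>findim_mod_kernel\<close>, since the values lie in eA; for the
    spanning set \<open>G\<close> primeness confines it to \<open>I\<close>.\<close>
  define K where "K H = {a. \<forall>g\<in>H. e * g * a \<in> I}" for H
  have subK: "subspace (K H)" for H
    by (auto simp: K_def subspace_def distrib_left scale_mult_right I_add I_scale)
  have "\<exists>T. finite T \<and> UNIV \<subseteq> span (T \<union> K H)" if "finite H" for H
    using that
  proof (induction H)
    case empty
    then show ?case by (intro exI[of _ "{}"]) (simp add: K_def)
  next
    case (insert g H)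
    then obtain T where T: "finite T" "UNIV \<subseteq> span (T \<union> K H)" by blast
    have "findim_mod I ((\<lambda>a. e * g * a) ` K H)"
      by (rule findim_mod_subset[OF findim_right_ideal]) (auto simp: mult.assoc)
    then have "\<exists>Y. finite Y \<and> K H \<subseteq> span (Y \<union> {a \<in> K H. e * g * a \<in> I})"
      by (intro findim_mod_kernel sub subK) (simp_all add: distrib_left scale_mult_right)
    moreover have "{a \<in> K H. e * g * a \<in> I} = K (insert g H)"
      by (auto simp: K_def)
    ultimately obtain Y where Y: "finite Y" "K H \<subseteq> span (Y \<union> K (insert g H))"
      by auto
    have "span (T \<union> K H) \<subseteq> span (T \<union> Y \<union> K (insert g H))"
    proof (rule span_minimal)
      have "span (Y \<union> K (insert g H)) \<subseteq> span (T \<union> Y \<union> K (insert g H))" by (rule span_mono) auto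
      with Y show "T \<union> K H \<subseteq> span (T \<union> Y \<union> K (insert g H))" by (auto intro: span_base)
    qed simp
    with T Y show ?case by (intro exI[of _ "T \<union> Y"]) auto
  qed
  from this[OF G(1)] obtain T where T: "finite T" "UNIV \<subseteq> span (T \<union> K G)" by blast
  have "K G \<subseteq> I"
  proof
    fix a assume a: "a \<in> K G"
    have "e * b * a \<in> I" for b
    proof -
      have "e * (e * b) \<in> span ((\<lambda>g. e * g) ` G \<union> I)"
      proof (rule lmult_span)
        show "e * b \<in> span (G \<union> I)" using G by auto
      qed (auto intro!: span_base lI)
      then have "e * (e * b) * a \<in> span I"
        by (rule rmult_span) (use a in \<open>auto simp: K_def intro: rI\<close>)
      moreover have "e * (e * b) * a \<approx> e * b * a"
        using eqv_rmult[OF e_idem, of "b * a"] by (simp add: mult.assoc)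
      ultimately show ?thesis using eqv_mem by simp
    qed
    with prime[of e a] e_notin show "a \<in> I" by blast
  qed
  then have "span (T \<union> K G) \<subseteq> span (T \<union> I)" by (intro span_mono) auto
  with T have "findim_mod I UNIV" unfolding findim_mod_def by blast
  with infinite show False ..
qed

end

theorem (in acc_algebra) finite_dimensional: "\<not> infinite_dimensional scale"
proof
  assume inf: "infinite_dimensional scale"
  let ?S = "{J. two_sided_ideal J \<and> \<not> findim_mod J UNIV}"
  have "span (F \<union> {0}) = span F" for F
    using span_insert_0[of F] by simp
  then have "\<not> findim_mod {0} UNIV"
    using inf by (auto simp: findim_mod_def infinite_dimensional_def)
  moreover have "two_sided_ideal {0}" by (simp add: two_sided_ideal_def)
  ultimately have "{0} \<in> ?S" by simp
  \<comment> \<open>Two-sided ideals are left ideals, so the chain condition on the left provides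
    the maximal \<open>I\<close>.\<close>
  moreover have "left_ideal_of J" if "J \<in> ?S" for J
    using that by (auto simp: left_ideal_of_def two_sided_ideal_def)
  ultimately have "\<exists>I\<in>?S. \<forall>J\<in>?S. I \<subseteq> J \<longrightarrow> J = I"
    by (rule left_maximal)
  then obtain I where I: "I \<in> ?S" "\<forall>J\<in>?S. I \<subseteq> J \<longrightarrow> J = I" ..
  interpret just_infinite scale I
    by unfold_locales (use I in auto)
  obtain e where "e \<notin> I" "eqv (e * e) e" "\<forall>a b. e * b \<notin> I \<longrightarrow> a * (e * b) \<in> I \<longrightarrow> a * e \<in> I"
    using idempotent_exists by blast
  then interpret corner_division scale I e
    by unfold_locales auto
  show False by (rule contradiction)
qed

theorem (in unital_algebra) acc_algebra_of_left_noetherian: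
  assumes noeth: "left_noetherian (universal_enveloping_algebra scale commutator)"
  shows "acc_algebra scale"
proof unfold_locales
  interpret left: lie_module scale scale commutator "\<lambda>a x. a * x"
    by unfold_locales
      (simp_all add: distrib_left distrib_right scale_mult_left scale_mult_right commutator_def
        algebra_simps)
  \<comment> \<open>Right multiplication reverses products; the sign restores the bracket law, so
    left ideals of the enveloping algebra control right ideals of A.\<close>
  interpret right: lie_module scale scale commutator "\<lambda>a x. - (x * a)"
    by unfold_locales
      (simp_all add: distrib_left distrib_right scale_mult_left scale_mult_right commutator_def
        algebra_simps)
  fix J :: "nat \<Rightarrow> 'a set"
  assume "\<And>n. J n \<subseteq> J (Suc n)"
  then have mono: "J m \<subseteq> J n" if "m \<le> n" for m n
    using that by (rule lift_Suc_mono_le)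
  show "\<exists>N. \<forall>n\<ge>N. J n = J N" if J: "\<And>n. left_ideal_of (J n)"
  proof -
    \<comment> \<open>Observing at the vector 1 recovers the ideals themselves, as
      \<open>a * 1\<close> is \<open>a\<close>.\<close>
    have "\<exists>N. \<forall>n\<ge>N. \<forall>a. a * 1 \<in> J n \<longrightarrow> a * 1 \<in> J N"
      by (rule left.left_noetherian_stabilizes[OF noeth])
        (use J mono in \<open>auto simp: left_ideal_of_def\<close>)
    then obtain N where N: "\<forall>n\<ge>N. \<forall>a. a \<in> J n \<longrightarrow> a \<in> J N"
      by (auto simp only: mult_1_right)
    have "J n = J N" if "n \<ge> N" for n
      using N mono[OF that] that by blast
    then show ?thesis by blast
  qed
  show "\<exists>N. \<forall>n\<ge>N. J n = J N" if J: "\<And>n. right_ideal_of (J n)"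
  proof -
    have neg: "- a \<in> J n \<longleftrightarrow> a \<in> J n" for a n
      using J[of n] subspace_neg[of "J n" a] subspace_neg[of "J n" "- a"]
      by (auto simp: right_ideal_of_def)
    have "\<exists>N. \<forall>n\<ge>N. \<forall>a. - (1 * a) \<in> J n \<longrightarrow> - (1 * a) \<in> J N"
      by (rule right.left_noetherian_stabilizes[OF noeth])
        (use J mono neg in \<open>auto simp: right_ideal_of_def\<close>)
    then obtain N where N: "\<forall>n\<ge>N. \<forall>a. a \<in> J n \<longrightarrow> a \<in> J N"
      by (auto simp only: mult_1_left neg)
    have "J n = J N" if "n \<ge> N" for n
      using N mono[OF that] that by blast
    then show ?thesis by blast
  qed
qed (rule commuting_sequence_dependent[OF noeth])

theorem corollary1p2:
  fixes scale :: "'k::field_char_0 \<Rightarrow> 'a::ring_1 \<Rightarrow> 'a"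
  assumes "unital_algebra scale"
    and "infinite_dimensional scale"
  shows "\<not> noetherian (universal_enveloping_algebra scale commutator)"
proof
  assume "noetherian (universal_enveloping_algebra scale commutator)"
  then have noeth: "left_noetherian (universal_enveloping_algebra scale commutator)"
    by (simp add: noetherian_def)
  interpret unital_algebra scale by fact
  interpret acc_algebra scale by (rule acc_algebra_of_left_noetherian[OF noeth])
  show False using finite_dimensional assms(2) by blast
qed

end
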